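(* Let $n\ge1$ and let $w_n\in S_{n+1}$ be the permutation with $w_n(1)=1$ and $w_n(i)=n+3-i$ for $2\le i\le n+1$. To each rc-graph $D$ for $w_n$ associate a bracketing of the string of letters $1,2,\dots,n+1$ as follows: for each $(i,j)\in E(D)$ (the set of positions of nontrivial elbow joints of $D$), place a left bracket before the letter $j$ and a right bracket after the letter $n+2-i$. Then: (a) this is a proper full bracketing of the string $1\,2\cdots(n+1)$ for a binary nonassociative operation, and for each elbow joint in $E(D)$ the two brackets placed for it form a matching pair (so, in the corresponding rooted binary tree with $n+1$ leaves, the elbow joints in $E(D)$ correspond to the internal nodes); (b) the resulting map is a bijection from the set of rc-graphs for $w_n$ to the set of full bracketings of a string of length $n+1$ (equivalently, to the set of rooted plane binary trees with $n+1$ leaves); (c) under this map, the involution on rc-graphs for $w_n$ given by transposition (reflecting the array across its main diagonal, $(i,j)\mapsto(j,i)$) corresponds to reversing the string together with its brackets, equivalently to flipping the binary tree about its vertical axis.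
   Context: An rc-graph for a permutation $w\in S_m$ is a filling of the upper-left half of an $m\times m$ array, i.e. of the positions $(i,j)$ (row $i$ counted from the top, column $j$ counted from the left) with $i,j\ge1$ and $i+j\le m+1$, by cross pieces and elbow joints. A cross piece lets one strand pass straight through horizontally (left edge to right edge) and another straight through vertically (bottom edge to top edge). An elbow joint connects the left edge to the top edge and the bottom edge to the right edge. Every position on the anti-diagonal $i+j=m+1$ is an elbow joint (a trivial one), of which only the strand from the left edge to the top edge is used. The filling must satisfy: for each $i$, the strand entering at the left of row $i$ exits at the top of column $w(i)$; and no two strands cross more than once (equivalently, there are exactly $\ell(w)$ cross pieces, where $\ell(w)$ is the number of inversions of $w$). Transposing an rc-graph for $w$ gives an rc-graph for $w^{-1}$, and $w_n^{-1}=w_n$. For an rc-graph $D$ for $w_n$ (so $m=n+1$), $E(D)$ is the set of positions $(i,j)$ with $i+j\le n+1$ at which $D$ has an elbow joint. A full bracketing of a string of length $n+1$ is a complete parenthesization of a product of $n+1$ letters under a binary nonassociative operation, including the outermost pair of brackets and with no brackets around single letters; it has exactly $n$ pairs of matching brackets, each enclosing the product of exactly two factors, a factor being a letter or a bracketed expression. Full bracketings correspond in the obvious way to rooted plane binary trees (each internal node having exactly two ordered children) with $n+1$ leaves, with matching pairs of brackets corresponding to internal nodes. After reversal, the letters are relabeled $1,\dots,n+1$ from left to right. *)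

theory Defs
  imports "HOL-Library.Tree" "HOL-Combinatorics.Permutations"
begin

section \<open>Rc-graphs\<close>

text \<open>
  A filling of the staircase \<open>{(i, j). 1 \<le> i \<and> 1 \<le> j \<and> i + j \<le> m + 1}\<close> is represented by the set
  \<open>D\<close> of positions of its cross pieces; every other position carries an elbow joint.
  Positions are (row, column), rows counted from the top.

  A strand travels right and up.  \<open>strand D k i j s\<close> says that the strand which enters at the left
  of row \<open>k\<close> enters position \<open>(i, j)\<close> through its left (\<open>West\<close>) or bottom (\<open>South\<close>) edge.
  The fictitious row 0 lies above the array: \<open>strand D k 0 j South\<close> says that the strand exits
  at the top of column \<open>j\<close>.
\<close>

datatype side = West | South

inductive strand :: "(nat \<times> nat) set \<Rightarrow> nat \<Rightarrow> nat \<Rightarrow> nat \<Rightarrow> side \<Rightarrow> bool"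
  for D :: "(nat \<times> nat) set" and k :: nat
where
  start: "strand D k k 1 West"
| cross_west:
    "strand D k (Suc i) j West \<Longrightarrow> (Suc i, j) \<in> D \<Longrightarrow> strand D k (Suc i) (Suc j) West"
| cross_south:
    "strand D k (Suc i) j South \<Longrightarrow> (Suc i, j) \<in> D \<Longrightarrow> strand D k i j South"
| elbow_west:
    "strand D k (Suc i) j West \<Longrightarrow> (Suc i, j) \<notin> D \<Longrightarrow> strand D k i j South"
| elbow_south:
    "strand D k (Suc i) j South \<Longrightarrow> (Suc i, j) \<notin> D \<Longrightarrow> strand D k (Suc i) (Suc j) West"

definition crossings :: "(nat \<times> nat) set \<Rightarrow> nat \<Rightarrow> nat \<Rightarrow> (nat \<times> nat) set" where
  "crossings D a b =
     {(i, j) \<in> D. strand D a i j West \<and> strand D b i j South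
                \<or> strand D b i j West \<and> strand D a i j South}"

text \<open>The bound \<open>i + j \<le> m\<close> (not \<open>m + 1\<close>) expresses that the anti-diagonal consists of elbows.\<close>

definition rc_graphs :: "nat \<Rightarrow> (nat \<Rightarrow> nat) \<Rightarrow> (nat \<times> nat) set set" where
  "rc_graphs m w =
     {D. D \<subseteq> {(i, j). 1 \<le> i \<and> 1 \<le> j \<and> i + j \<le> m}
       \<and> (\<forall>i\<in>{1..m}. strand D i 0 (w i) South)
       \<and> (\<forall>a\<in>{1..m}. \<forall>b\<in>{1..m}. a \<noteq> b \<longrightarrow> card (crossings D a b) \<le> 1)}"

definition w_perm :: "nat \<Rightarrow> nat \<Rightarrow> nat" where
  "w_perm n i = (if 2 \<le> i \<and> i \<le> n + 1 then n + 3 - i else i)"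

lemma w_perm_permutes: "w_perm n permutes {1..n + 1}"
proof (rule bij_imp_permutes)
  have "w_perm n ` {1..n + 1} \<subseteq> {1..n + 1}"
    by (auto simp: w_perm_def)
  moreover have "inj_on (w_perm n) {1..n + 1}"
    by (auto simp: inj_on_def w_perm_def split: if_splits)
  ultimately show "bij_betw (w_perm n) {1..n + 1} {1..n + 1}"
    by (simp add: bij_betw_def endo_inj_surj)
qed (auto simp: w_perm_def)

text \<open>Nontrivial elbow joints, for \<open>m = n + 1\<close>.\<close>

definition elbows :: "nat \<Rightarrow> (nat \<times> nat) set \<Rightarrow> (nat \<times> nat) set" where
  "elbows n D = {(i, j). 1 \<le> i \<and> 1 \<le> j \<and> i + j \<le> n + 1 \<and> (i, j) \<notin> D}"


section \<open>Bracketings\<close>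

datatype token = LB | RB | Letter nat

inductive full_bracketing :: "nat list \<Rightarrow> token list \<Rightarrow> bool" where
  letter: "full_bracketing [a] [Letter a]"
| product: "full_bracketing xs s \<Longrightarrow> full_bracketing ys t \<Longrightarrow>
    full_bracketing (xs @ ys) ([LB] @ s @ t @ [RB])"

definition balanced :: "token list \<Rightarrow> bool" where
  "balanced u \<longleftrightarrow> count_list u RB = count_list u LB \<and>
     (\<forall>l \<le> length u. count_list (take l u) RB \<le> count_list (take l u) LB)"

text \<open>Pairs of indices (starting from 0) of matching brackets in a string.\<close>

definition matching_pairs :: "token list \<Rightarrow> (nat \<times> nat) set" where
  "matching_pairs s = {(p, q). p < q \<and> q < length s \<and> s ! p = LB \<and> s ! q = RB
     \<and> balanced (take (q - Suc p) (drop (Suc p) s))}"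

text \<open>The index \<open>p\<close> belongs to the block of left brackets directly before the letter \<open>a\<close>,
  respectively \<open>q\<close> to the block of right brackets directly after the letter \<open>b\<close>.\<close>

definition left_bracket_before :: "token list \<Rightarrow> nat \<Rightarrow> nat \<Rightarrow> bool" where
  "left_bracket_before s p a \<longleftrightarrow>
     (\<exists>x > p. x < length s \<and> s ! x = Letter a \<and> (\<forall>y\<in>{p..<x}. s ! y = LB))"

definition right_bracket_after :: "token list \<Rightarrow> nat \<Rightarrow> nat \<Rightarrow> bool" where
  "right_bracket_after s q b \<longleftrightarrow>
     q < length s \<and> (\<exists>x < q. s ! x = Letter b \<and> (\<forall>y\<in>{x<..q}. s ! y = RB))"

text \<open>Each \<open>(i, j) \<in> elbows n D\<close> contributes a left bracket before the letter \<open>j\<close> and a right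
  bracket after the letter \<open>n + 2 - i\<close>.\<close>

definition bracketing :: "nat \<Rightarrow> (nat \<times> nat) set \<Rightarrow> token list" where
  "bracketing n D = concat (map (\<lambda>k.
       replicate (card {(i, j) \<in> elbows n D. j = k}) LB
       @ [Letter k]
       @ replicate (card {(i, j) \<in> elbows n D. n + 2 - i = k}) RB) [1..<n + 2])"

fun flip_token :: "token \<Rightarrow> token" where
  "flip_token LB = RB"
| "flip_token RB = LB"
| "flip_token (Letter a) = Letter a"

fun relabel :: "nat \<Rightarrow> token list \<Rightarrow> token list" where
  "relabel k [] = []"
| "relabel k (Letter a # s) = Letter k # relabel (Suc k) s"
| "relabel k (LB # s) = LB # relabel k s"
| "relabel k (RB # s) = RB # relabel k s"

definition reverse_bracketing :: "token list \<Rightarrow> token list" where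
  "reverse_bracketing s = relabel 1 (rev (map flip_token s))"


section \<open>Binary trees\<close>

text \<open>For a tree \<open>t\<close>, \<open>size1 t\<close> is its number of leaves and \<open>mirror t\<close> its reflection in the
  vertical axis.\<close>

type_synonym plane_tree = "unit tree"

text \<open>The bracketing belonging to a tree whose leaves are labelled \<open>k, k + 1, \<dots>\<close>.\<close>

fun tree_string :: "nat \<Rightarrow> plane_tree \<Rightarrow> token list" where
  "tree_string k Leaf = [Letter k]"
| "tree_string k (Node l _ r) = [LB] @ tree_string k l @ tree_string (k + size1 l) r @ [RB]"

definition tree_of :: "token list \<Rightarrow> plane_tree" where
  "tree_of s = (THE t. tree_string 1 t = s)"

text \<open>Internal nodes are addressed by the path from the root (\<open>False\<close>: left, \<open>True\<close>: right).
  The span of a node consists of the labels of the first and the last leaf below it,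
  the leaves of the whole tree being labelled \<open>k, k + 1, \<dots>\<close>.\<close>

fun internal_nodes :: "plane_tree \<Rightarrow> bool list set" where
  "internal_nodes Leaf = {}"
| "internal_nodes (Node l _ r) =
     {[]} \<union> Cons False ` internal_nodes l \<union> Cons True ` internal_nodes r"

fun leaf_span :: "nat \<Rightarrow> plane_tree \<Rightarrow> bool list \<Rightarrow> nat \<times> nat" where
  "leaf_span k t [] = (k, k + size1 t - 1)"
| "leaf_span k Leaf (_ # v) = undefined"
| "leaf_span k (Node l _ r) (False # v) = leaf_span k l v"
| "leaf_span k (Node l _ r) (True # v) = leaf_span (k + size1 l) r v"

lemma tree_string_append_inject:
  "tree_string k t @ u = tree_string k t' @ u' \<Longrightarrow> t = t' \<and> u = u'"
proof (induction t arbitrary: k t' u u')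
  case Leaf
  then show ?case by (cases t') auto
next
  case (Node l x r)
  have "t' \<noteq> Leaf"
    using Node.prems by auto
  then obtain l' y r' where t': "t' = Node l' y r'"
    by (meson neq_Leaf_iff)
  have
    *: "tree_string k l @ tree_string (k + size1 l) r @ RB # u
      = tree_string k l' @ tree_string (k + size1 l') r' @ RB # u'"
    using Node.prems unfolding t' by simp
  from Node.IH(1)[OF *] have l: "l = l'"
    and "tree_string (k + size1 l) r @ RB # u = tree_string (k + size1 l') r' @ RB # u'"
    by blast+
  from Node.IH(2)[OF this(2)[folded this(1)]] show ?case
    unfolding t' l by simp
qed

lemma tree_of_tree_string: "tree_of (tree_string 1 t) = t"
  unfolding tree_of_def
proof (rule the_equality)
  fix t' assume "tree_string 1 t' = tree_string 1 t"
  then show "t' = t"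
    using tree_string_append_inject[of 1 t' "[]" t "[]"] by simp
qed simp

lemma full_bracketing_tree_string:
  "full_bracketing [k..<k + size1 t] (tree_string k t)"
proof (induction t arbitrary: k)
  case Leaf
  show ?case using full_bracketing.letter[of k] by simp
next
  case (Node l x r)
  have "[k..<k + size1 l] @ [k + size1 l..<k + size1 l + size1 r] = [k..<k + size1 (Node l x r)]"
    unfolding upt_add_eq_append[OF le_add1, symmetric] by (simp add: add.assoc)
  with full_bracketing.product[OF Node.IH(1)[of k] Node.IH(2)[of "k + size1 l"]]
  show ?case
    by (simp only: tree_string.simps)
qed

lemma full_bracketing_imp_tree_string:
  "full_bracketing xs s \<Longrightarrow> xs = [k..<k + length xs] \<Longrightarrow>
     \<exists>t. size1 t = length xs \<and> tree_string k t = s"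
proof (induction arbitrary: k rule: full_bracketing.induct)
  case (letter a)
  then have "size1 (Leaf :: plane_tree) = length [a] \<and> tree_string k Leaf = [Letter a]"
    by simp
  then show ?case by blast
next
  case (product xs s ys u)
  have "xs @ ys = [k..<k + length xs + length ys]"
    by (subst product.prems) (simp only: length_append add.assoc)
  also have "\<dots> = [k..<k + length xs] @ [k + length xs..<k + length xs + length ys]"
    by (rule upt_add_eq_append) simp
  finally have "xs = [k..<k + length xs] \<and> ys = [k + length xs..<k + length xs + length ys]"
    by (rule iffD1[OF append_eq_append_conv, rotated]) simp
  then obtain t1 t2 where
    "size1 t1 = length xs" "tree_string k t1 = s"
    "size1 t2 = length ys" "tree_string (k + length xs) t2 = u"
    using product.IH(1)[of k] product.IH(2)[of "k + length xs"] by blast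
  then have "size1 (Node t1 () t2) = length (xs @ ys)
      \<and> tree_string k (Node t1 () t2) = [LB] @ s @ u @ [RB]"
    by simp
  then show ?case by blast
qed

lemma bij_betw_tree_of:
  "bij_betw tree_of {s. full_bracketing [1..<n + 2] s} {t. size1 t = n + 1}"
proof -
  have eq: "tree_string 1 ` {t. size1 t = n + 1} = {s. full_bracketing [1..<n + 2] s}"
  proof (intro equalityI subsetI)
    fix s assume "s \<in> tree_string 1 ` {t. size1 t = n + 1}"
    then obtain t where t: "size1 t = n + 1" "s = tree_string 1 t"
      by blast
    have "[1..<1 + size1 t] = [1..<n + 2]"
      by (rule arg_cong2[where f = upt]) (use t in simp_all)
    with full_bracketing_tree_string[of 1 t] t(2)
    show "s \<in> {s. full_bracketing [1..<n + 2] s}"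
      by (simp only: mem_Collect_eq)
  next
    fix s assume "s \<in> {s. full_bracketing [1..<n + 2] s}"
    then have s: "full_bracketing [1..<n + 2] s"
      by blast
    have l: "length [1..<n + 2] = n + 1"
      by (simp only: length_upt)
    have "1 + (n + 1) = n + 2"
      by simp
    with full_bracketing_imp_tree_string[OF s, of 1]
    show "s \<in> tree_string 1 ` {t. size1 t = n + 1}"
      unfolding l by (simp only:) blast
  qed
  show ?thesis
    unfolding eq[symmetric] bij_betw_def inj_on_def
    by (simp add: tree_of_tree_string image_image del: One_nat_def)
qed


section \<open>Correspondences\<close>

definition one_to_one :: "('a \<Rightarrow> 'b \<Rightarrow> bool) \<Rightarrow> 'a set \<Rightarrow> 'b set \<Rightarrow> bool" where
  "one_to_one R A B \<longleftrightarrow> (\<forall>a\<in>A. \<exists>!b. b \<in> B \<and> R a b) \<and> (\<forall>b\<in>B. \<exists>!a. a \<in> A \<and> R a b)"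

text \<open>The brackets at \<open>p\<close> and \<open>q\<close> stand where the two brackets for the elbow \<open>(i, j)\<close> are placed.\<close>

definition placed_for :: "nat \<Rightarrow> token list \<Rightarrow> nat \<times> nat \<Rightarrow> nat \<times> nat \<Rightarrow> bool" where
  "placed_for n s = (\<lambda>(i, j) (p, q). left_bracket_before s p j \<and> right_bracket_after s q (n + 2 - i))"

definition node_of_elbow :: "nat \<Rightarrow> plane_tree \<Rightarrow> nat \<times> nat \<Rightarrow> bool list \<Rightarrow> bool" where
  "node_of_elbow n t = (\<lambda>(i, j) v. leaf_span 1 t v = (j, n + 2 - i))"

end

theory Submission
  imports Defs
begin

text \<open>
  In coordinates \<open>(j, r)\<close> with \<open>r = n + 2 - i\<close>, the elbow joint \<open>(i, j)\<close> becomes the span of letters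
  from \<open>j\<close> to \<open>r\<close>, and the fillings for \<open>w_n\<close> are exactly those whose elbow joints are the spans of
  the internal nodes of a tree.

  Given an rc-graph, the position \<open>(1, n + 1)\<close> is an elbow since the strand entering in the top row
  exits in column 1.  Let \<open>k\<close> be the largest row letter below the top with an elbow in column 1.  The
  strand from row \<open>k\<close> goes up column 1, turns into the top row and has to leave it in column
  \<open>k + 1\<close>; a strand from a row between \<open>k\<close> and the top that turned up in one of the columns
  \<open>1, \<dots>, k\<close> would exit there, which is too far left.  So the rectangle between is filled with
  crosses, and what remains are two smaller staircases satisfying the same exit condition, on the
  letters \<open>1, \<dots>, k\<close> and \<open>k + 1, \<dots>, n + 1\<close>.

  Conversely, a gap between the letters \<open>e\<close> and \<open>e + 1\<close> is split by a unique node, with span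
  \<open>(p, q)\<close> say, and the strand from row \<open>e\<close> passes just the elbows \<open>(p, e)\<close>, \<open>(p, q)\<close> and
  \<open>(e + 1, q)\<close>, which are the left child, the node and the right child.  As spans are nested or
  disjoint, two such strands cross only once.
\<close>

section \<open>Strands and the exit condition\<close>

text \<open>The row is given by its letter \<open>r\<close>, so strands travel towards larger \<open>r\<close>; \<open>Q j r\<close> says that
  there is an elbow.  No top boundary is built in.\<close>

type_synonym state = "nat \<times> nat \<times> side"

fun step :: "(nat \<Rightarrow> nat \<Rightarrow> bool) \<Rightarrow> state \<Rightarrow> state" where
  "step Q (r, j, West) = (if Q j r then (Suc r, j, South) else (r, Suc j, West))"
| "step Q (r, j, South) = (if Q j r then (r, Suc j, West) else (Suc r, j, South))"

text \<open>Iterating a function gives each strand a single course, so statements about its exit can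
  be carried along it as equivalences.\<close>

definition visits :: "(nat \<Rightarrow> nat \<Rightarrow> bool) \<Rightarrow> state \<Rightarrow> state \<Rightarrow> bool" where
  "visits Q x y \<longleftrightarrow> (\<exists>m. (step Q ^^ m) x = y)"

text \<open>A \<open>South\<close> state in row \<open>N\<close> is an entry from below; with
  \<open>N\<close> one above the top letter it is the exit from the staircase.\<close>

abbreviation leads :: "(nat \<Rightarrow> nat \<Rightarrow> bool) \<Rightarrow> state \<Rightarrow> nat \<Rightarrow> nat \<Rightarrow> bool" where
  "leads Q x N c \<equiv> visits Q x (N, c, South)"

text \<open>A step either moves up or stays in its row and ends at a \<open>West\<close> edge. So no
  row is entered twice through \<open>South\<close>, which makes exits unique.\<close>

lemma funpow_step_row:
  "(step Q ^^ m) (r, j, s) = (r', j', s') \<Longrightarrow> r < r' \<or> r = r' \<and> (m = 0 \<or> s' = West)"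
proof (induction m arbitrary: r' j' s')
  case (Suc m)
  obtain r1 j1 s1 where x: "(step Q ^^ m) (r, j, s) = (r1, j1, s1)"
    by (metis prod_cases3)
  from Suc.IH[OF x] Suc.prems x show ?case
    by (cases s1) (auto split: if_splits)
qed simp

lemma funpow_step_column:
  "(step Q ^^ m) (r, j, s) = (r', j', s') \<Longrightarrow> j \<le> j'"
proof (induction m arbitrary: r' j' s')
  case (Suc m)
  obtain r1 j1 s1 where x: "(step Q ^^ m) (r, j, s) = (r1, j1, s1)"
    by (metis prod_cases3)
  from Suc.IH[OF x] Suc.prems x show ?case
    by (cases s1) (auto split: if_splits)
qed simp

lemma leads_column_le: "leads Q (r, j, s) N c \<Longrightarrow> j \<le> c"
  unfolding visits_def using funpow_step_column by blast

lemma leads_same_row [simp]: "leads Q (N, j, South) N c \<longleftrightarrow> j = c"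
  unfolding visits_def
proof
  assume "\<exists>m. (step Q ^^ m) (N, j, South) = (N, c, South)"
  then obtain m where m: "(step Q ^^ m) (N, j, South) = (N, c, South)" ..
  from funpow_step_row[OF m] have "m = 0" by simp
  with m show "j = c" by simp
next
  assume "j = c"
  then show "\<exists>m. (step Q ^^ m) (N, j, South) = (N, c, South)"
    by (intro exI[of _ 0]) simp
qed

text \<open>Below row \<open>N\<close> the target is not yet reached, so a first iteration can be
  split off.\<close>

lemma leads_step:
  assumes "r < N"
  shows "leads Q (r, j, s) N c \<longleftrightarrow> leads Q (step Q (r, j, s)) N c"
proof
  assume "leads Q (r, j, s) N c"
  then obtain m where m: "(step Q ^^ m) (r, j, s) = (N, c, South)"
    unfolding visits_def ..
  with assms obtain m' where "m = Suc m'"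
    by (cases m) auto
  with m show "leads Q (step Q (r, j, s)) N c"
    unfolding visits_def by (auto simp: funpow_Suc_right simp del: funpow.simps)
next
  assume "leads Q (step Q (r, j, s)) N c"
  then obtain m where "(step Q ^^ m) (step Q (r, j, s)) = (N, c, South)"
    unfolding visits_def ..
  then have "(step Q ^^ Suc m) (r, j, s) = (N, c, South)"
    by (simp add: funpow_Suc_right del: funpow.simps)
  then show "leads Q (r, j, s) N c"
    unfolding visits_def ..
qed

lemma leads_elbow_West: "r < N \<Longrightarrow> Q j r \<Longrightarrow> leads Q (r, j, West) N c \<longleftrightarrow> leads Q (Suc r, j, South) N c"
  and leads_elbow_South: "r < N \<Longrightarrow> Q j r \<Longrightarrow> leads Q (r, j, South) N c \<longleftrightarrow> leads Q (r, Suc j, West) N c"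
  by (simp_all add: leads_step)

lemma leads_along_row:
  assumes "j \<le> j'" "r < N" "\<And>i. j \<le> i \<Longrightarrow> i < j' \<Longrightarrow> \<not> Q i r"
  shows "leads Q (r, j, West) N c \<longleftrightarrow> leads Q (r, j', West) N c"
  using assms by (induction j' rule: dec_induct) (simp_all add: leads_step[of _ _ _ _ West])

lemma leads_along_column:
  assumes "r \<le> r'" "r' \<le> N" "\<And>i. r \<le> i \<Longrightarrow> i < r' \<Longrightarrow> \<not> Q j i"
  shows "leads Q (r, j, South) N c \<longleftrightarrow> leads Q (r', j, South) N c"
  using assms by (induction r' rule: dec_induct) (simp_all add: leads_step[of _ _ _ _ South])

text \<open>Both targets lie on one orbit, and as rows never decrease, the lower one is not met
  after the higher one.\<close>

lemma leads_cancel: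
  assumes "leads Q x M c" "leads Q x N d" "M \<le> N"
  shows "leads Q (M, c, South) N d"
proof -
  from assms obtain m m' where
    m: "(step Q ^^ m) x = (M, c, South)" and m': "(step Q ^^ m') x = (N, d, South)"
    unfolding visits_def by blast
  show ?thesis
  proof (cases "m \<le> m'")
    case True
    then have "m' = (m' - m) + m" by simp
    then have "(step Q ^^ m') x = (step Q ^^ (m' - m)) ((step Q ^^ m) x)"
      by (metis comp_apply funpow_add)
    with m m' show ?thesis
      unfolding visits_def by metis
  next
    case False
    then have "m = (m - m') + m'" by simp
    then have "(step Q ^^ m) x = (step Q ^^ (m - m')) ((step Q ^^ m') x)"
      by (metis comp_apply funpow_add)
    with m m' have "(step Q ^^ (m - m')) (N, d, South) = (M, c, South)"
      by simp
    from funpow_step_row[OF this] assms(3) False show ?thesis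
      by auto
  qed
qed

text \<open>The diagonal elbow stops every horizontal run.\<close>

lemma first_elbow_in_row:
  fixes Q :: "nat \<Rightarrow> nat \<Rightarrow> bool"
  assumes "Q r r" "j \<le> r"
  shows "\<exists>c. j \<le> c \<and> c \<le> r \<and> Q c r \<and> (\<forall>i. j \<le> i \<and> i < c \<longrightarrow> \<not> Q i r)"
proof -
  define c where "c = (LEAST c. j \<le> c \<and> Q c r)"
  have "j \<le> c \<and> Q c r"
    unfolding c_def by (rule LeastI[of _ r]) (use assms in simp)
  moreover have "c \<le> r"
    unfolding c_def by (rule Least_le) (use assms in simp)
  moreover have "\<not> Q i r" if "j \<le> i" "i < c" for i
    using not_less_Least[of i "\<lambda>c. j \<le> c \<and> Q c r"] that unfolding c_def by blast
  ultimately show ?thesis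
    by blast
qed

text \<open>In the last row a strand leaves through the first elbow it meets, so the exit column
  locates that elbow. This is how exits yield information about the filling.\<close>

lemma leads_top_row:
  assumes "leads Q (r, j, West) (Suc r) c" "Q r r" "j \<le> r"
  shows "Q c r" "\<And>i. j \<le> i \<Longrightarrow> i < c \<Longrightarrow> \<not> Q i r"
proof -
  obtain c' where c': "j \<le> c'" "Q c' r" "\<And>i. j \<le> i \<Longrightarrow> i < c' \<Longrightarrow> \<not> Q i r"
    using first_elbow_in_row[of Q, OF assms(2,3)] by blast
  have "leads Q (r, j, West) (Suc r) c \<longleftrightarrow> leads Q (r, c', West) (Suc r) c"
    using c' by (intro leads_along_row) auto
  also have "\<dots> \<longleftrightarrow> c' = c"
    using c'(2) by (simp add: leads_elbow_West)
  finally have "c' = c"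
    using assms(1) by blast
  with c' show "Q c r" "\<And>i. j \<le> i \<Longrightarrow> i < c \<Longrightarrow> \<not> Q i r"
    by blast+
qed

text \<open>The diagonal elbow of row \<open>r\<close> turns the strand up no later than in column
  \<open>r\<close>, so it enters the next row again strictly left of the diagonal.\<close>

lemma leads_South_ex:
  assumes "j < r" "r \<le> N" "\<And>i. r \<le> i \<Longrightarrow> i < N \<Longrightarrow> Q i i"
  shows "\<exists>c<N. leads Q (r, j, South) N c"
  using assms(2,1,3)
proof (induction r arbitrary: j rule: inc_induct)
  case (step r)
  show ?case
  proof (cases "Q j r")
    case True
    obtain c where c: "Suc j \<le> c" "c \<le> r" "Q c r" "\<And>i. Suc j \<le> i \<Longrightarrow> i < c \<Longrightarrow> \<not> Q i r"
      using first_elbow_in_row[of Q r "Suc j", OF step.prems(2)[OF le_refl step.hyps(2)] Suc_leI[OF step.prems(1)]]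
      by blast
    have "leads Q (r, j, South) N d \<longleftrightarrow> leads Q (Suc r, c, South) N d" for d
      using leads_along_row[of "Suc j" c r N Q d] c step.hyps True
      by (simp add: leads_elbow_South leads_elbow_West)
    with step.IH[of c] step.prems c show ?thesis by auto
  next
    case False
    then have "leads Q (r, j, South) N d \<longleftrightarrow> leads Q (Suc r, j, South) N d" for d
      using step.hyps by (simp add: leads_step)
    with step.IH[of j] step.prems show ?thesis by auto
  qed
qed auto

lemma leads_West_ex:
  assumes "j \<le> r" "r < N" "\<And>i. r \<le> i \<Longrightarrow> i < N \<Longrightarrow> Q i i"
  shows "\<exists>c<N. leads Q (r, j, West) N c"
proof -
  obtain c where c: "j \<le> c" "c \<le> r" "Q c r" "\<And>i. j \<le> i \<Longrightarrow> i < c \<Longrightarrow> \<not> Q i r"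
    using first_elbow_in_row[of Q r j, OF assms(3)[OF le_refl assms(2)] assms(1)] by blast
  have "leads Q (r, j, West) N d \<longleftrightarrow> leads Q (Suc r, c, South) N d" for d
    using leads_along_row[of j c r N Q d] c assms by (simp add: leads_elbow_West)
  with leads_South_ex[of c "Suc r" N Q] assms c show ?thesis by auto
qed

section \<open>From the exit condition to a tree\<close>

definition node_spans :: "nat \<Rightarrow> plane_tree \<Rightarrow> (nat \<times> nat) set" where
  "node_spans k t = leaf_span k t ` internal_nodes t"

lemma node_spans_Leaf [simp]: "node_spans k Leaf = {}"
  by (simp add: node_spans_def)

lemma node_spans_Node [simp]:
  "node_spans k (Node l x r) =
     insert (k, Suc (k + size l + size r)) (node_spans k l \<union> node_spans (Suc (k + size l)) r)"
  by (simp add: node_spans_def image_Un image_image size1_size ac_simps)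

text \<open>The exit condition for the staircase on the letters \<open>a, \<dots>, b\<close>, as part of a larger filling.\<close>

definition exits :: "(nat \<Rightarrow> nat \<Rightarrow> bool) \<Rightarrow> nat \<Rightarrow> nat \<Rightarrow> bool" where
  "exits Q a b \<longleftrightarrow> leads Q (b, a, West) (Suc b) a
     \<and> (\<forall>r. a \<le> r \<and> r < b \<longrightarrow> leads Q (r, a, West) (Suc b) (Suc r))"

text \<open>Strong induction on \<open>b - a\<close>: the staircase is cut after the last letter
  \<open>k\<close> of the left child, and both pieces inherit the exit condition. A single letter
  gives a leaf.\<close>

lemma exits_imp_tree:
  assumes "a \<le> b" "\<And>r. a \<le> r \<Longrightarrow> r \<le> b \<Longrightarrow> Q r r" "exits Q a b"
  shows "\<exists>t. a + size t = b \<and> node_spans a t = {(j, r). a \<le> j \<and> j < r \<and> r \<le> b \<and> Q j r}"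
  using assms
proof (induction "b - a" arbitrary: a b rule: less_induct)
  case less
  note Q = less.prems(2)
  from less.prems(3) have top: "leads Q (b, a, West) (Suc b) a"
    and ex: "\<And>r. a \<le> r \<Longrightarrow> r < b \<Longrightarrow> leads Q (r, a, West) (Suc b) (Suc r)"
    unfolding exits_def by auto
  show ?case
  proof (cases "a = b")
    case True
    then show ?thesis
      by (intro exI[of _ Leaf]) auto
  next
    case False
    then have "a < b" using less.prems by simp
    \<comment> \<open>The letter \<open>a\<close> qualifies by its diagonal elbow;
      \<open>k = a\<close> means that the left child is a leaf.\<close>
    define k where "k = (GREATEST k. a \<le> k \<and> k < b \<and> Q a k)"
    have k: "a \<le> k \<and> k < b \<and> Q a k"
      unfolding k_def
      by (rule GreatestI_nat[of _ a b]) (use \<open>a < b\<close> Q in auto)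
    have col: "\<not> Q a r" if "k < r" "r < b" for r
      using Greatest_le_nat[of "\<lambda>k. a \<le> k \<and> k < b \<and> Q a k" r b] that k
      unfolding k_def by fastforce
    have root: "Q a b"
      using leads_top_row[OF top] Q less.prems by blast
    \<comment> \<open>This strand turns at once into column \<open>a\<close>, climbs to the root
      elbow and turns there; its exit then fixes the next elbow of row \<open>b\<close>.\<close>
    have "leads Q (k, a, West) (Suc b) (Suc k)"
      using ex k by blast
    also have "leads Q (k, a, West) (Suc b) (Suc k) \<longleftrightarrow> leads Q (Suc k, a, South) (Suc b) (Suc k)"
      using k by (intro leads_elbow_West) auto
    also have "\<dots> \<longleftrightarrow> leads Q (b, a, South) (Suc b) (Suc k)"
      using k col by (intro leads_along_column) auto
    also have "\<dots> \<longleftrightarrow> leads Q (b, Suc a, West) (Suc b) (Suc k)"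
      using root by (intro leads_elbow_South) auto
    finally have *: "leads Q (b, Suc a, West) (Suc b) (Suc k)" .
    have right: "Q (Suc k) b" and row: "\<And>j. a < j \<Longrightarrow> j \<le> k \<Longrightarrow> \<not> Q j b"
      using leads_top_row[OF *] Q[of b] \<open>a < b\<close> by auto
    \<comment> \<open>Induction from row \<open>b\<close> downwards; the clause for
      \<open>r = b\<close> exempts the root elbow.\<close>
    have rect: "\<forall>c. a \<le> c \<and> c \<le> k \<and> (r = b \<longrightarrow> a < c) \<longrightarrow> \<not> Q c r" if "k < r" "r \<le> b" for r
      using that
    proof (induction "b - r" arbitrary: r rule: less_induct)
      case (less r)
      show ?case
      proof (cases "r = b")
        case True
        with row show ?thesis by auto
      next
        case False
        then have r: "k < r" "r < b" using less.prems by auto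
        obtain c where c: "a \<le> c" "c \<le> r" "Q c r" "\<And>i. a \<le> i \<Longrightarrow> i < c \<Longrightarrow> \<not> Q i r"
          using first_elbow_in_row[of Q r a, OF Q] r k
          by (metis le_trans less_imp_le_nat)
        \<comment> \<open>Otherwise the strand from row \<open>r\<close> would turn into a column
          known to be free of elbows above, and exit there instead of in column
          \<open>Suc r\<close>.\<close>
        have "k < c"
        proof (rule ccontr)
          assume "\<not> k < c"
          have "c \<noteq> a"
            using c col r by blast
          have "leads Q (r, a, West) (Suc b) (Suc r) \<longleftrightarrow> leads Q (r, c, West) (Suc b) (Suc r)"
            using c r by (intro leads_along_row) auto
          also have "\<dots> \<longleftrightarrow> leads Q (Suc r, c, South) (Suc b) (Suc r)"
            using c r by (intro leads_elbow_West) auto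
          also have "\<dots> \<longleftrightarrow> leads Q (Suc b, c, South) (Suc b) (Suc r)"
          proof (intro leads_along_column)
            fix i assume "Suc r \<le> i" "i < Suc b"
            then show "\<not> Q c i"
              using less.hyps[of i] r c(1) \<open>\<not> k < c\<close> \<open>c \<noteq> a\<close> by auto
          qed (use r in auto)
          finally have "c = Suc r"
            using ex[of r] r k by simp
          with \<open>\<not> k < c\<close> r show False by simp
        qed
        with c(4) show ?thesis by auto
      qed
    qed
    have "exits Q a k"
      unfolding exits_def
    proof (intro conjI allI impI)
      show "leads Q (k, a, West) (Suc k) a"
        using k by (simp add: leads_elbow_West)
      fix r assume r: "a \<le> r \<and> r < k"
      \<comment> \<open>In the row above \<open>k\<close>, column \<open>a\<close> would put the
        strand on the course of the strand from row \<open>k\<close>, which has a different exit;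
        any other column runs straight up, so it is already the exit column.\<close>
      have "\<exists>c<Suc k. leads Q (r, a, West) (Suc k) c"
        by (rule leads_West_ex) (use Q r k in auto)
      then obtain c where c: "c \<le> k" "leads Q (r, a, West) (Suc k) c"
        unfolding less_Suc_eq_le by blast
      have "leads Q (Suc k, c, South) (Suc b) (Suc r)"
        using leads_cancel[OF c(2) ex[of r]] r k by auto
      moreover have "leads Q (Suc k, c, South) (Suc b) d \<longleftrightarrow> leads Q (Suc b, c, South) (Suc b) d"
        if "c \<noteq> a" for d
        using that rect leads_column_le[OF c(2)] k c by (intro leads_along_column) auto
      moreover have "leads Q (Suc k, a, South) (Suc b) (Suc k)"
        using \<open>leads Q (k, a, West) (Suc b) (Suc k)\<close> k by (simp add: leads_elbow_West)
      moreover note leads_cancel[of Q "(Suc k, a, South)" "Suc b" "Suc k" "Suc b" "Suc r"]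
      ultimately have "c = Suc r"
        using r by (cases "c = a") auto
      with c show "leads Q (r, a, West) (Suc k) (Suc r)" by simp
    qed
    then have "\<exists>t. a + size t = k \<and> node_spans a t = {(j, r). a \<le> j \<and> j < r \<and> r \<le> k \<and> Q j r}"
      by (rule less.hyps[rotated 3]) (use Q k in auto)
    then obtain l where
      l: "a + size l = k" "node_spans a l = {(j, r). a \<le> j \<and> j < r \<and> r \<le> k \<and> Q j r}"
      by blast
    have "exits Q (Suc k) b"
      unfolding exits_def
    proof (intro conjI allI impI)
      show "leads Q (b, Suc k, West) (Suc b) (Suc k)"
        using right by (simp add: leads_elbow_West)
      fix r assume r: "Suc k \<le> r \<and> r < b"
      \<comment> \<open>By \<open>rect\<close> the strand passes straight through columns
        \<open>a\<close> to \<open>k\<close> and enters the right staircase unturned.\<close>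
      have "leads Q (r, a, West) (Suc b) (Suc r) \<longleftrightarrow> leads Q (r, Suc k, West) (Suc b) (Suc r)"
        using rect r k by (intro leads_along_row) auto
      with ex[of r] r k show "leads Q (r, Suc k, West) (Suc b) (Suc r)" by simp
    qed
    then have "\<exists>t. Suc k + size t = b
        \<and> node_spans (Suc k) t = {(j, r). Suc k \<le> j \<and> j < r \<and> r \<le> b \<and> Q j r}"
      by (rule less.hyps[rotated 3]) (use Q k in auto)
    then obtain r where
      r: "Suc k + size r = b"
        "node_spans (Suc k) r = {(j, r). Suc k \<le> j \<and> j < r \<and> r \<le> b \<and> Q j r}"
      by blast
    have "node_spans a (Node l () r) = insert (a, b) (node_spans a l \<union> node_spans (Suc k) r)"
      using l(1) r(1) by auto
    also have "\<dots> = {(j, r). a \<le> j \<and> j < r \<and> r \<le> b \<and> Q j r}" (is "?L = ?R")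
    proof
      show "?L \<subseteq> ?R"
        unfolding l(2) r(2) using root k \<open>a < b\<close> by auto
      show "?R \<subseteq> ?L"
      proof
        fix x assume "x \<in> ?R"
        then obtain j s where x: "x = (j, s)" "a \<le> j" "j < s" "s \<le> b" "Q j s"
          by blast
        consider "s \<le> k" | "k < j" | "k < s" "j \<le> k"
          by linarith
        then show "x \<in> ?L"
        proof cases
          \<comment> \<open>Within the rectangle and row \<open>b\<close> left of the right child,
            \<open>rect\<close> leaves only the root.\<close>
          case 3
          with rect[of s] x show ?thesis by auto
        qed (use x l(2) r(2) in auto)
      qed
    qed
    finally show ?thesis
      using l(1) r(1) by (intro exI[of _ "Node l () r"]) simp
  qed
qed


section \<open>Strands in the filling of a tree\<close>

text \<open>The span of the node whose left child ends with \<open>e\<close> and whose right child begins with \<open>e + 1\<close>.\<close>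

fun gap_node :: "nat \<Rightarrow> plane_tree \<Rightarrow> nat \<Rightarrow> nat \<times> nat" where
  "gap_node k Leaf e = (k, k)"
| "gap_node k (Node l _ r) e =
     (if e < k + size l then gap_node k l e
      else if e = k + size l then (k, Suc (k + size l + size r))
      else gap_node (Suc (k + size l)) r e)"

lemma node_spans_bounds: "(p, q) \<in> node_spans k t \<Longrightarrow> k \<le> p \<and> p < q \<and> q \<le> k + size t"
  by (induction t arbitrary: k) fastforce+

lemma root_in_node_spans: "t \<noteq> Leaf \<Longrightarrow> (k, k + size t) \<in> node_spans k t"
  by (cases t) auto

text \<open>\<open>(p, e)\<close> and \<open>(Suc e, q)\<close> are the children's spans, possibly
  single leaves. The negative facts say that these are the widest spans ending with \<open>e\<close>
  and beginning with \<open>Suc e\<close>, and that \<open>(p, q)\<close> is the next wider one with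
  the same left or right end. They clear the strand's straight stretches.\<close>

lemma gap_node_props:
  assumes "k \<le> e" "e < k + size t" "gap_node k t e = (p, q)"
  shows "k \<le> p" "p \<le> e" "e < q" "q \<le> k + size t" "(p, q) \<in> node_spans k t"
    and "p = e \<or> (p, e) \<in> node_spans k t"
    and "Suc e = q \<or> (Suc e, q) \<in> node_spans k t"
    and "j < p \<Longrightarrow> (j, e) \<notin> node_spans k t"
    and "e < r \<Longrightarrow> r < q \<Longrightarrow> (p, r) \<notin> node_spans k t"
    and "p < j \<Longrightarrow> j \<le> e \<Longrightarrow> (j, q) \<notin> node_spans k t"
    and "q < r \<Longrightarrow> (Suc e, r) \<notin> node_spans k t"
proof -
  have "k \<le> p \<and> p \<le> e \<and> e < q \<and> q \<le> k + size t \<and> (p, q) \<in> node_spans k t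
    \<and> (p = e \<or> (p, e) \<in> node_spans k t) \<and> (Suc e = q \<or> (Suc e, q) \<in> node_spans k t)
    \<and> (\<forall>j<p. (j, e) \<notin> node_spans k t) \<and> (\<forall>r. e < r \<and> r < q \<longrightarrow> (p, r) \<notin> node_spans k t)
    \<and> (\<forall>j. p < j \<and> j \<le> e \<longrightarrow> (j, q) \<notin> node_spans k t) \<and> (\<forall>r>q. (Suc e, r) \<notin> node_spans k t)"
    using assms
  proof (induction t arbitrary: k)
    case (Node l x r)
    note bl = node_spans_bounds[of _ _ k l] and br = node_spans_bounds[of _ _ "Suc (k + size l)" r]
    consider "e < k + size l" | "e = k + size l" | "Suc (k + size l) \<le> e"
      by linarith
    then show ?case
    proof cases
      case 1
      with Node.prems have *: "k \<le> e" "gap_node k l e = (p, q)" by auto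
      from Node.IH(1)[OF *(1) 1 *(2)] 1 show ?thesis
        by (auto dest: br)
    next
      case 2
      with Node.prems have [simp]: "p = k" "q = Suc (k + size l + size r)" by auto
      have "k = e \<or> (k, e) \<in> node_spans k l"
        using root_in_node_spans[of l k] 2 by (cases l) auto
      moreover have "Suc e = q \<or> (Suc e, q) \<in> node_spans (Suc (k + size l)) r"
        using root_in_node_spans[of r "Suc (k + size l)"] 2 by (cases r) (auto simp: ac_simps)
      ultimately show ?thesis
        using 2 by (auto dest: node_spans_bounds)
    next
      case 3
      with Node.prems have *: "e < Suc (k + size l) + size r" "gap_node (Suc (k + size l)) r e = (p, q)" by auto
      from Node.IH(2)[OF 3 *] 3 show ?thesis
        by (auto dest: bl)
    qed
  qed simp
  then show "k \<le> p" "p \<le> e" "e < q" "q \<le> k + size t" "(p, q) \<in> node_spans k t"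
    "p = e \<or> (p, e) \<in> node_spans k t"
    "Suc e = q \<or> (Suc e, q) \<in> node_spans k t"
    "j < p \<Longrightarrow> (j, e) \<notin> node_spans k t"
    "e < r \<Longrightarrow> r < q \<Longrightarrow> (p, r) \<notin> node_spans k t"
    "p < j \<Longrightarrow> j \<le> e \<Longrightarrow> (j, q) \<notin> node_spans k t"
    "q < r \<Longrightarrow> (Suc e, r) \<notin> node_spans k t"
    by blast+
qed

text \<open>Two nodes are disjoint or one lies below a child of the other; \<open>e < e'\<close>
  decides which child: the left one of the second node or the right one of the first.\<close>

lemma gap_node_laminar:
  assumes "k \<le> e" "e < e'" "e' < k + size t" "gap_node k t e = (p, q)" "gap_node k t e' = (p', q')"
  shows "q < p' \<or> p' \<le> p \<and> q \<le> e' \<or> e < p' \<and> q' \<le> q"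
  using assms
proof (induction t arbitrary: k)
  case (Node l x r)
  note gl = gap_node_props(1-4)[of k _ l] and gr = gap_node_props(1-4)[of "Suc (k + size l)" _ r]
  consider "e' < k + size l" | "e < k + size l" "e' = k + size l" | "e < k + size l" "k + size l < e'"
    | "e = k + size l" | "Suc (k + size l) \<le> e"
    by linarith
  then show ?case
  proof cases
    case 1
    with Node.prems Node.IH(1)[of k] show ?thesis by auto
  next
    case 2
    with Node.prems gl[of e p q] show ?thesis by auto
  next
    case 3
    with Node.prems gl[of e p q] gr[of e' p' q'] show ?thesis by auto
  next
    case 4
    with Node.prems gr[of e' p' q'] show ?thesis by auto
  next
    case 5
    with Node.prems Node.IH(2)[of "Suc (k + size l)"] show ?thesis by auto
  qed
qed simp

text \<open>The diagonal elbows act as spans of leaves, so a child that is a leaf needs no separate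
  treatment. Outside the staircase \<open>Q\<close> is arbitrary.\<close>

definition tree_elbows :: "(nat \<Rightarrow> nat \<Rightarrow> bool) \<Rightarrow> nat \<Rightarrow> plane_tree \<Rightarrow> bool" where
  "tree_elbows Q a t \<longleftrightarrow>
     (\<forall>j r. a \<le> j \<and> j \<le> r \<and> r \<le> a + size t \<longrightarrow> Q j r \<longleftrightarrow> j = r \<or> (j, r) \<in> node_spans a t)"

lemma tree_elbows_gap_node:
  assumes "tree_elbows Q a t" "a \<le> e" "e < a + size t" "gap_node a t e = (p, q)"
  shows "Q p e" "Q p q" "Q (Suc e) q"
    and "a \<le> j \<Longrightarrow> j < p \<Longrightarrow> \<not> Q j e"
    and "e < r \<Longrightarrow> r < q \<Longrightarrow> \<not> Q p r"
    and "p < j \<Longrightarrow> j \<le> e \<Longrightarrow> \<not> Q j q"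
    and "q < r \<Longrightarrow> r \<le> a + size t \<Longrightarrow> \<not> Q (Suc e) r"
proof -
  note g = gap_node_props[OF assms(2-4)]
  have Q: "Q j r \<longleftrightarrow> j = r \<or> (j, r) \<in> node_spans a t" if "a \<le> j" "j \<le> r" "r \<le> a + size t" for j r
    using assms(1) that unfolding tree_elbows_def by blast
  show "Q p e" using Q[of p e] g(1-4,6) by auto
  show "Q p q" using Q[of p q] g(1-5) by auto
  show "Q (Suc e) q" using Q[of "Suc e" q] g(1-4,7) by auto
  show "a \<le> j \<Longrightarrow> j < p \<Longrightarrow> \<not> Q j e" using Q[of j e] g(1-4) g(8)[of j] by auto
  show "e < r \<Longrightarrow> r < q \<Longrightarrow> \<not> Q p r" using Q[of p r] g(1-4) g(9)[of r] by auto
  show "p < j \<Longrightarrow> j \<le> e \<Longrightarrow> \<not> Q j q" using Q[of j q] g(1-4) g(10)[of j] by auto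
  show "q < r \<Longrightarrow> r \<le> a + size t \<Longrightarrow> \<not> Q (Suc e) r" using Q[of "Suc e" r] g(1-4) g(11)[of r] by auto
qed

lemma tree_elbows_root: "tree_elbows Q a t \<Longrightarrow> Q a (a + size t)"
  using root_in_node_spans[of t a] unfolding tree_elbows_def by (cases t) auto

text \<open>The equivalences follow the strand from row \<open>e\<close>: along row \<open>e\<close>
  to column \<open>p\<close>, up to row \<open>q\<close>, along to column \<open>Suc e\<close>, and
  up to the exit.\<close>

lemma tree_elbows_exits:
  assumes "tree_elbows Q a t"
  shows "exits Q a (a + size t)"
  unfolding exits_def
proof (intro conjI allI impI)
  let ?b = "a + size t"
  show "leads Q (?b, a, West) (Suc ?b) a"
    using tree_elbows_root[OF assms] by (simp add: leads_elbow_West)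
  fix e assume e: "a \<le> e \<and> e < ?b"
  obtain p q where pq: "gap_node a t e = (p, q)"
    by fastforce
  note g = gap_node_props(1-4)[of a e t, OF _ _ pq] and
    Q = tree_elbows_gap_node[OF assms _ _ pq]
  have "leads Q (e, a, West) (Suc ?b) (Suc e) \<longleftrightarrow> leads Q (e, p, West) (Suc ?b) (Suc e)"
    using e g Q by (intro leads_along_row) auto
  also have "\<dots> \<longleftrightarrow> leads Q (Suc e, p, South) (Suc ?b) (Suc e)"
    using e Q by (intro leads_elbow_West) auto
  also have "\<dots> \<longleftrightarrow> leads Q (q, p, South) (Suc ?b) (Suc e)"
    using e g Q by (intro leads_along_column) auto
  also have "\<dots> \<longleftrightarrow> leads Q (q, Suc p, West) (Suc ?b) (Suc e)"
    using e g Q by (intro leads_elbow_South) auto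
  also have "\<dots> \<longleftrightarrow> leads Q (q, Suc e, West) (Suc ?b) (Suc e)"
    using e g Q by (intro leads_along_row) auto
  also have "\<dots> \<longleftrightarrow> leads Q (Suc q, Suc e, South) (Suc ?b) (Suc e)"
    using e g Q by (intro leads_elbow_West) auto
  also have "\<dots> \<longleftrightarrow> leads Q (Suc ?b, Suc e, South) (Suc ?b) (Suc e)"
    using e g Q by (intro leads_along_column) auto
  finally show "leads Q (e, a, West) (Suc ?b) (Suc e)" by simp
qed

text \<open>The course of the strand from row \<open>e\<close>, where \<open>(p, q)\<close> is the span of the node at the gap
  after \<open>e\<close>.\<close>

fun on_path :: "nat \<Rightarrow> nat \<Rightarrow> nat \<times> nat \<Rightarrow> state \<Rightarrow> bool" where
  "on_path a e (p, q) (r, j, West) \<longleftrightarrow> a \<le> j \<and> (r = e \<and> j \<le> p \<or> r = q \<and> p < j \<and> j \<le> Suc e)"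
| "on_path a e (p, q) (r, j, South) \<longleftrightarrow> e < r \<and> r \<le> q \<and> j = p \<or> q < r \<and> j = Suc e"

lemma funpow_invariant:
  assumes "P x" "\<And>x. P x \<Longrightarrow> P (f x)"
  shows "P ((f ^^ m) x)"
  using assms by (induction m) auto

lemma visits_on_path:
  assumes "tree_elbows Q a t" "a \<le> e" "e < a + size t"
    and "visits Q (e, a, West) (r, j, s)" "r \<le> a + size t"
  shows "on_path a e (gap_node a t e) (r, j, s)"
proof -
  let ?b = "a + size t"
  obtain p q where pq: "gap_node a t e = (p, q)"
    by fastforce
  note g = gap_node_props(1-4)[of a e t, OF assms(2,3) pq] and
    Q = tree_elbows_gap_node[OF assms(1-3) pq]
  obtain m where m: "(step Q ^^ m) (e, a, West) = (r, j, s)"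
    using assms(4) unfolding visits_def by blast
  \<comment> \<open>The invariant is guarded by the top row because nothing is known about
    \<open>Q\<close> above it; rows never decrease, so the guard passes back to earlier
    states.\<close>
  have "fst ((step Q ^^ m) (e, a, West)) \<le> ?b \<longrightarrow> on_path a e (p, q) ((step Q ^^ m) (e, a, West))"
  proof (rule funpow_invariant)
    show "fst (e, a, West) \<le> ?b \<longrightarrow> on_path a e (p, q) (e, a, West)"
      using g by simp
  next
    fix x assume x: "fst x \<le> ?b \<longrightarrow> on_path a e (p, q) x"
    obtain r j s where [simp]: "x = (r, j, s)"
      by (metis prod_cases3)
    show "fst (step Q x) \<le> ?b \<longrightarrow> on_path a e (p, q) (step Q x)"
    proof
      assume *: "fst (step Q x) \<le> ?b"
      then have "r \<le> ?b" by (cases s) (auto split: if_splits)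
      with x have o: "on_path a e (p, q) (r, j, s)" by simp
      show "on_path a e (p, q) (step Q x)"
      proof (cases s)
        case West
        with o consider "r = e" "a \<le> j" "j < p" | "r = e" "j = p" | "r = q" "p < j" "j \<le> e" | "r = q" "j = Suc e"
          by fastforce
        then show ?thesis
          using West g Q by cases auto
      next
        case South
        with o consider "e < r" "r < q" "j = p" | "r = q" "j = p" | "q < r" "j = Suc e"
          by fastforce
        then show ?thesis
          using South g Q \<open>r \<le> ?b\<close> by cases auto
      qed
    qed
  qed
  with m assms(5) pq show ?thesis by simp
qed

text \<open>The strand of the top row meets the root elbow first and leaves the staircase
  there.\<close>

lemma visits_from_root:
  assumes "tree_elbows Q a t" "visits Q (a + size t, a, West) (r, j, s)" "r \<le> a + size t"
  shows "r = a + size t" "j = a" "s = West"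
proof -
  obtain m where m: "(step Q ^^ m) (a + size t, a, West) = (r, j, s)"
    using assms(2) unfolding visits_def by blast
  have "fst x \<le> a + size t \<longrightarrow> x = (a + size t, a, West)" if "x = (step Q ^^ m) (a + size t, a, West)" for x
    unfolding that
  proof (rule funpow_invariant)
    fix x assume "fst x \<le> a + size t \<longrightarrow> x = (a + size t, a, West)"
    with tree_elbows_root[OF assms(1)]
    show "fst (step Q x) \<le> a + size t \<longrightarrow> step Q x = (a + size t, a, West)"
      by (cases x; cases "snd (snd x)") (auto split: if_splits)
  qed simp
  with m assms(3) show "r = a + size t" "j = a" "s = West" by auto
qed

text \<open>Each laminar case leaves one meeting point without an elbow, and there the strand from
  the smaller letter is the vertical one.\<close>

lemma on_path_crossing_unique:
  assumes Q: "tree_elbows Q a t" and e: "a \<le> e" "e < e'" "e' < a + size t"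
  shows "\<not> Q j r \<Longrightarrow>
    \<not> (on_path a e (gap_node a t e) (r, j, West) \<and> on_path a e' (gap_node a t e') (r, j, South))"
  and "\<exists>c. \<forall>r j. \<not> Q j r \<longrightarrow> on_path a e' (gap_node a t e') (r, j, West)
      \<longrightarrow> on_path a e (gap_node a t e) (r, j, South) \<longrightarrow> (r, j) = c"
proof -
  obtain p q p' q' where pq: "gap_node a t e = (p, q)" and pq': "gap_node a t e' = (p', q')"
    by fastforce
  have le: "e < a + size t" "a \<le> e'" using e by auto
  note g = gap_node_props(1-4)[of a e t, OF e(1) le(1) pq] gap_node_props(1-4)[of a e' t, OF le(2) e(3) pq'] and
    Q = tree_elbows_gap_node(1-3)[OF Q e(1) le(1) pq] tree_elbows_gap_node(1-3)[OF Q le(2) e(3) pq']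
  consider "q < p'" | "p' \<le> p" "q \<le> e'" | "e < p'" "q' \<le> q"
    using gap_node_laminar[OF e pq pq'] by blast
  note cases = this
  { assume "\<not> Q j r"
    from cases
    show "\<not> (on_path a e (gap_node a t e) (r, j, West) \<and> on_path a e' (gap_node a t e') (r, j, South))"
    proof cases
      case 3
      \<comment> \<open>If the second node is the right child of the first, both strands turn at
        their common elbow \<open>(Suc e, q)\<close> and do not cross.\<close>
      then have "q = q' \<and> p' = Suc e \<or> q' < q \<or> Suc e < p'" by linarith
      with 3 \<open>\<not> Q j r\<close> g Q e show ?thesis unfolding pq pq' by auto
    qed (use g e in \<open>auto simp: pq pq'\<close>) }
  \<comment> \<open>Witnesses: in column \<open>Suc e\<close>, the first strand crosses row
    \<open>e'\<close> for disjoint nodes and row \<open>q'\<close> when its node lies below the left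
    child of the other; in the last case it crosses row \<open>e'\<close> while still in column
    \<open>p\<close>.\<close>
  from cases
  show "\<exists>c. \<forall>r j. \<not> Q j r \<longrightarrow> on_path a e' (gap_node a t e') (r, j, West)
      \<longrightarrow> on_path a e (gap_node a t e) (r, j, South) \<longrightarrow> (r, j) = c"
  proof cases
    case 1
    with g e show ?thesis unfolding pq pq' by (intro exI[of _ "(e', Suc e)"]) auto
  next
    case 2
    then have "q = e' \<or> q < e'" by linarith
    with 2 g Q e show ?thesis unfolding pq pq' by (intro exI[of _ "(q', Suc e)"]) auto
  next
    case 3
    with g e show ?thesis unfolding pq pq' by (intro exI[of _ "(e', p)"]) auto
  qed
qed


section \<open>Rc-graphs and trees\<close>

abbreviation letter_elbow :: "nat \<Rightarrow> (nat \<times> nat) set \<Rightarrow> nat \<Rightarrow> nat \<Rightarrow> bool" where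
  "letter_elbow n D j r \<equiv> (n + 2 - r, j) \<notin> D"

lemma visits_refl: "visits Q x x"
  unfolding visits_def by (rule exI[of _ 0]) simp

lemma visits_step: "visits Q x y \<Longrightarrow> step Q y = z \<Longrightarrow> visits Q x z"
  unfolding visits_def by (metis comp_apply funpow.simps(2))

text \<open>The row bound is carried through the induction so that \<open>n + 2 - i\<close> is never
  truncated.\<close>

lemma strand_imp_visits:
  assumes "strand D k i j s" "k \<le> n + 1"
  shows "i \<le> n + 1 \<and> visits (letter_elbow n D) (n + 2 - k, 1, West) (n + 2 - i, j, s)"
  using assms(1)
proof induction
  case start
  show ?case using assms(2) by (simp add: visits_refl)
next
  case (cross_west i j)
  then show ?case by (auto elim!: visits_step)
next
  case (cross_south i j)
  then show ?case by (auto elim!: visits_step)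
next
  case (elbow_west i j)
  then show ?case by (auto elim!: visits_step)
next
  case (elbow_south i j)
  then show ?case by (auto elim!: visits_step)
qed

text \<open>The bound on \<open>r\<close> stops at the exit into the fictitious row 0:
  \<open>step\<close> would run on, \<open>strand\<close> does not.\<close>

lemma visits_imp_strand:
  assumes "visits (letter_elbow n D) (n + 2 - k, 1, West) (r, j, s)" "k \<le> n + 1"
    and "r \<le> n + 1 \<or> r = n + 2 \<and> s = South"
  shows "strand D k (n + 2 - r) j s"
proof -
  obtain m where "(step (letter_elbow n D) ^^ m) (n + 2 - k, 1, West) = (r, j, s)"
    using assms(1) unfolding visits_def by blast
  then show ?thesis
    using assms(3)
  proof (induction m arbitrary: r j s)
    case 0
    with assms(2) strand.start[of D k] show ?case by auto
  next
    case (Suc m)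
    obtain r1 j1 s1 where x: "(step (letter_elbow n D) ^^ m) (n + 2 - k, 1, West) = (r1, j1, s1)"
      by (metis prod_cases3)
    with Suc.prems have st: "step (letter_elbow n D) (r1, j1, s1) = (r, j, s)"
      by simp
    with Suc.prems(2) have r1: "r1 \<le> n + 1"
      by (cases s1) (auto split: if_splits)
    with Suc.IH[OF x] have "strand D k (n + 2 - r1) j1 s1" by blast
    moreover have "n + 2 - r1 = Suc (n + 1 - r1)" using r1 by simp
    ultimately have *: "strand D k (Suc (n + 1 - r1)) j1 s1" by simp
    show ?case
      using st r1 strand.intros(2-5)[of D k "n + 1 - r1" j1] *
      by (cases s1) (auto split: if_splits simp: Suc_diff_le)
  qed
qed

section \<open>The correspondence between fillings and trees\<close>

definition corresponds :: "nat \<Rightarrow> (nat \<times> nat) set \<Rightarrow> plane_tree \<Rightarrow> bool" where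
  "corresponds n D t \<longleftrightarrow> D \<subseteq> {(i, j). 1 \<le> i \<and> 1 \<le> j \<and> i + j \<le> n + 1} \<and> size t = n
     \<and> (\<forall>j r. 1 \<le> j \<and> j < r \<and> r \<le> n + 1 \<longrightarrow> letter_elbow n D j r \<longleftrightarrow> (j, r) \<in> node_spans 1 t)"

lemma corresponds_tree_elbows:
  assumes "corresponds n D t"
  shows "tree_elbows (letter_elbow n D) 1 t"
  unfolding tree_elbows_def
proof (intro allI impI)
  fix j r assume *: "1 \<le> j \<and> j \<le> r \<and> r \<le> 1 + size t"
  show "letter_elbow n D j r \<longleftrightarrow> j = r \<or> (j, r) \<in> node_spans 1 t"
  proof (cases "j = r")
    case True
    with assms * show ?thesis unfolding corresponds_def by auto
  next
    case False
    with assms * show ?thesis unfolding corresponds_def by auto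
  qed
qed

text \<open>Row 1 has letter \<open>n + 1\<close> and exits in column 1; a row \<open>i >= 2\<close>
  has letter \<open>r = n + 2 - i\<close> and exits in column \<open>n + 3 - i = Suc r\<close>. This
  is the condition \<open>exits\<close>.\<close>

lemma rc_graph_imp_corresponds:
  assumes "D \<in> rc_graphs (n + 1) (w_perm n)"
  shows "\<exists>t. corresponds n D t"
proof -
  let ?Q = "letter_elbow n D"
  from assms have sub: "D \<subseteq> {(i, j). 1 \<le> i \<and> 1 \<le> j \<and> i + j \<le> n + 1}"
    and st: "\<And>i. 1 \<le> i \<Longrightarrow> i \<le> n + 1 \<Longrightarrow> strand D i 0 (w_perm n i) South"
    unfolding rc_graphs_def by auto
  have leads: "leads ?Q (n + 2 - i, 1, West) (n + 2) (w_perm n i)" if "1 \<le> i" "i \<le> n + 1" for i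
    using strand_imp_visits[OF st[OF that] that(2)] by simp
  have "exits ?Q 1 (n + 1)"
    unfolding exits_def
  proof (intro conjI allI impI)
    show "leads ?Q (n + 1, 1, West) (Suc (n + 1)) 1"
      using leads[of 1] by (simp add: w_perm_def)
  next
    fix r assume r: "1 \<le> r \<and> r < n + 1"
    then have "w_perm n (n + 2 - r) = Suc r" "n + 2 - (n + 2 - r) = r"
      by (auto simp: w_perm_def)
    moreover have "leads ?Q (n + 2 - (n + 2 - r), 1, West) (n + 2) (w_perm n (n + 2 - r))"
      by (rule leads) (use r in auto)
    ultimately have "leads ?Q (r, 1, West) (n + 2) (Suc r)"
      by (simp only:)
    then show "leads ?Q (r, 1, West) (Suc (n + 1)) (Suc r)"
      by simp
  qed
  moreover have "?Q r r" if "1 \<le> r" "r \<le> n + 1" for r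
    using sub that by auto
  ultimately obtain t where
    "1 + size t = n + 1" "node_spans 1 t = {(j, r). 1 \<le> j \<and> j < r \<and> r \<le> n + 1 \<and> ?Q j r}"
    using exits_imp_tree[of 1 "n + 1" ?Q] by auto
  with sub show ?thesis
    unfolding corresponds_def by auto
qed

lemma corresponds_crossings:
  assumes D: "corresponds n D t" and ab: "1 \<le> a" "a < b" "b \<le> n + 1"
  shows "card (crossings D a b) \<le> 1"
proof -
  let ?Q = "letter_elbow n D"
  note t = corresponds_tree_elbows[OF D]
  have D_sub: "D \<subseteq> {1..n} \<times> {1..n}" and [simp]: "size t = n"
    using D unfolding corresponds_def by auto
  have bound: "1 \<le> i \<and> i \<le> n" if "(i, j) \<in> D" for i j
    using that D_sub by auto
  have cross: "\<not> ?Q j (n + 2 - i)" if "(i, j) \<in> D" for i j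
    using that bound[OF that] by simp
  have visits: "visits ?Q (n + 2 - k, 1, West) (n + 2 - i, j, s)" if "strand D k i j s" "k \<le> n + 1" for k i j s
    using strand_imp_visits[OF that] by blast
  have "\<exists>c. crossings D a b \<subseteq> {c}"
  proof (cases "a = 1")
    case True
    \<comment> \<open>The strand of the top row visits only the root elbow of the array, so it
      crosses nothing.\<close>
    have "\<not> strand D a i j s" if "(i, j) \<in> D" for i j s
    proof
      assume "strand D a i j s"
      then have *: "visits ?Q (1 + size t, 1, West) (n + 2 - i, j, s)"
        using visits[of a i j s] True by simp
      from visits_from_root(1,2)[OF t this] bound[OF that] have "n + 2 - i = 1 + n" "j = 1"
        by auto
      then have "i = 1" "j = 1"
        using bound[OF that] by auto
      with tree_elbows_root[OF t] that show False
        by simp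
    qed
    then show ?thesis
      unfolding crossings_def by blast
  next
    case False
    \<comment> \<open>Letters run against rows, so the lower row \<open>b\<close> gets the smaller
      letter.\<close>
    define e e' where "e = n + 2 - b" and "e' = n + 2 - a"
    have e: "1 \<le> e" "e < e'" "e' < 1 + size t"
      using ab False unfolding e_def e'_def by auto
    have path: "on_path 1 e (gap_node 1 t e) (n + 2 - i, j, s)"
      if "(i, j) \<in> D" "strand D b i j s" for i j s
      by (rule visits_on_path[OF t]) (use e ab bound[OF that(1)] visits[OF that(2)] in \<open>auto simp: e_def\<close>)
    have path': "on_path 1 e' (gap_node 1 t e') (n + 2 - i, j, s)"
      if "(i, j) \<in> D" "strand D a i j s" for i j s
      by (rule visits_on_path[OF t]) (use e ab bound[OF that(1)] visits[OF that(2)] in \<open>auto simp: e'_def\<close>)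
    obtain c where c: "\<And>r j. \<not> ?Q j r \<Longrightarrow> on_path 1 e' (gap_node 1 t e') (r, j, West)
      \<Longrightarrow> on_path 1 e (gap_node 1 t e) (r, j, South) \<Longrightarrow> (r, j) = c"
      using on_path_crossing_unique(2)[OF t e] by blast
    have "crossings D a b \<subseteq> {(n + 2 - fst c, snd c)}"
    proof
      fix x assume "x \<in> crossings D a b"
      then obtain i j where x: "x = (i, j)" "(i, j) \<in> D" and
        *: "strand D a i j West \<and> strand D b i j South \<or> strand D b i j West \<and> strand D a i j South"
        unfolding crossings_def by auto
      from * on_path_crossing_unique(1)[OF t e cross[OF x(2)]] path[OF x(2)] path'[OF x(2)]
      have "(n + 2 - i, j) = c"
        using c[OF cross[OF x(2)]] by blast
      then show "x \<in> {(n + 2 - fst c, snd c)}"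
        using x bound[OF x(2)] by auto
    qed
    then show ?thesis by blast
  qed
  then obtain c where "crossings D a b \<subseteq> {c}" ..
  from card_mono[OF _ this] show ?thesis by simp
qed

lemma crossings_commute: "crossings D a b = crossings D b a"
  unfolding crossings_def by auto

lemma corresponds_imp_rc_graph:
  assumes D: "corresponds n D t"
  shows "D \<in> rc_graphs (n + 1) (w_perm n)"
proof -
  let ?Q = "letter_elbow n D"
  have sub: "D \<subseteq> {(i, j). 1 \<le> i \<and> 1 \<le> j \<and> i + j \<le> n + 1}" and [simp]: "size t = n"
    using D unfolding corresponds_def by auto
  have ex: "exits ?Q 1 (1 + n)"
    using tree_elbows_exits[OF corresponds_tree_elbows[OF D]] by simp
  have "strand D i 0 (w_perm n i) South" if i: "1 \<le> i" "i \<le> n + 1" for i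
  proof -
    have "leads ?Q (n + 2 - i, 1, West) (n + 2) (w_perm n i)"
    proof (cases "i = 1")
      case True
      with ex show ?thesis by (simp add: exits_def w_perm_def)
    next
      case False
      then have "w_perm n i = Suc (n + 2 - i)" "1 \<le> n + 2 - i" "n + 2 - i < 1 + n"
        using i by (auto simp: w_perm_def)
      with ex show ?thesis by (simp add: exits_def)
    qed
    from visits_imp_strand[OF this i(2)] show ?thesis by simp
  qed
  moreover have "card (crossings D a b) \<le> 1"
    if "a \<in> {1..n + 1}" "b \<in> {1..n + 1}" "a \<noteq> b" for a b
    using corresponds_crossings[OF D, of a b] corresponds_crossings[OF D, of b a]
      crossings_commute[of D a b] that by (cases "a < b") auto
  ultimately show ?thesis
    using sub unfolding rc_graphs_def by auto
qed


section \<open>The string and the mirror image\<close>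

lemma finite_node_spans: "finite (node_spans k t)"
  by (induction t arbitrary: k) auto

text \<open>The bounds on spans keep \<open>i\<close> in range, so truncated subtraction produces no
  spurious elbows.\<close>

lemma corresponds_elbows:
  assumes "corresponds n D t"
  shows "(i, j) \<in> elbows n D \<longleftrightarrow> (j, n + 2 - i) \<in> node_spans 1 t"
proof
  assume ij: "(i, j) \<in> elbows n D"
  then have "letter_elbow n D j (n + 2 - i)" "1 \<le> j" "j < n + 2 - i" "n + 2 - i \<le> n + 1"
    unfolding elbows_def by auto
  with assms show "(j, n + 2 - i) \<in> node_spans 1 t"
    unfolding corresponds_def by blast
next
  assume *: "(j, n + 2 - i) \<in> node_spans 1 t"
  from assms have "size t = n"
    unfolding corresponds_def by blast
  with node_spans_bounds[OF *] have b: "1 \<le> j" "j < n + 2 - i" "n + 2 - i \<le> n + 1"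
    by auto
  with assms * have "letter_elbow n D j (n + 2 - i)"
    unfolding corresponds_def by blast
  moreover have "n + 2 - (n + 2 - i) = i" "1 \<le> i" "i + j \<le> n + 1" using b by auto
  ultimately show "(i, j) \<in> elbows n D"
    using b unfolding elbows_def by simp
qed

lemma corresponds_ex:
  assumes "size t = n"
  shows "\<exists>D. corresponds n D t"
proof
  show "corresponds n {(i, j). 1 \<le> i \<and> 1 \<le> j \<and> i + j \<le> n + 1 \<and> (j, n + 2 - i) \<notin> node_spans 1 t} t"
    using assms unfolding corresponds_def by auto
qed

lemma corresponds_unique:
  assumes "corresponds n D t" "corresponds n D' t"
  shows "D = D'"
proof -
  have D: "D = {(i, j). 1 \<le> i \<and> 1 \<le> j \<and> i + j \<le> n + 1} - elbows n D" if "corresponds n D t" for D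
    using that unfolding corresponds_def elbows_def by auto
  have "elbows n D = elbows n D'"
    using corresponds_elbows[OF assms(1)] corresponds_elbows[OF assms(2)] by auto
  then show ?thesis
    using D[OF assms(1)] D[OF assms(2)] by simp
qed

section \<open>The string of a tree, letter by letter\<close>

definition letter_block :: "(nat \<times> nat) set \<Rightarrow> nat \<Rightarrow> token list" where
  "letter_block S c =
     replicate (card {q. (c, q) \<in> S}) LB @ [Letter c] @ replicate (card {p. (p, c) \<in> S}) RB"

lemma letter_block_cong:
  "(\<And>q. (c, q) \<in> S \<longleftrightarrow> (c, q) \<in> T) \<Longrightarrow> (\<And>p. (p, c) \<in> S \<longleftrightarrow> (p, c) \<in> T) \<Longrightarrow> letter_block S c = letter_block T c"
  unfolding letter_block_def by simp

lemma letter_block_insert_left: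
  assumes "finite S" "(c, b) \<notin> S" "b \<noteq> c"
  shows "letter_block (insert (c, b) S) c = LB # letter_block S c"
proof -
  have "{q. (c, q) \<in> insert (c, b) S} = insert b {q. (c, q) \<in> S}" by auto
  moreover have "finite {q. (c, q) \<in> S}"
    by (rule finite_subset[OF _ finite_imageI[OF assms(1), of snd]]) force
  ultimately show ?thesis
    using assms unfolding letter_block_def by simp
qed

lemma letter_block_insert_right:
  assumes "finite S" "(a, c) \<notin> S" "a \<noteq> c"
  shows "letter_block (insert (a, c) S) c = letter_block S c @ [RB]"
proof -
  have "{p. (p, c) \<in> insert (a, c) S} = insert a {p. (p, c) \<in> S}" by auto
  moreover have "finite {p. (p, c) \<in> S}"
    by (rule finite_subset[OF _ finite_imageI[OF assms(1), of fst]]) force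
  ultimately show ?thesis
    using assms unfolding letter_block_def by (simp add: replicate_append_same)
qed

text \<open>The root span adds one \<open>LB\<close> before the first block and one
  \<open>RB\<close> after the last; apart from that each block sees only the spans of its own
  child.\<close>

lemma concat_letter_blocks:
  "concat (map (letter_block (node_spans k t)) [k..<Suc (k + size t)]) = tree_string k t"
proof (induction t arbitrary: k)
  case Leaf
  show ?case by (simp add: letter_block_def)
next
  case (Node l x r)
  define m b where "m = k + size l" and "b = Suc m + size r"
  define L R S where "L = node_spans k l" and "R = node_spans (Suc m) r" and "S = insert (k, b) (L \<union> R)"
  have S: "node_spans k (Node l x r) = S"
    by (simp add: S_def L_def R_def m_def b_def)
  have L: "k \<le> p \<and> p < q \<and> q \<le> m" if "(p, q) \<in> L" for p q
    using node_spans_bounds that unfolding L_def m_def by blast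
  have R: "Suc m \<le> p \<and> p < q \<and> q \<le> b" if "(p, q) \<in> R" for p q
    using node_spans_bounds that unfolding R_def b_def by blast
  have fin: "finite L" "finite R"
    unfolding L_def R_def by (rule finite_node_spans)+
  have km: "k \<le> m" "m < b" unfolding m_def b_def by auto
  have left: "concat (map (letter_block S) [k..<Suc m]) = LB # tree_string k l"
  proof -
    have "letter_block S k = letter_block (insert (k, b) L) k"
      using R km by (intro letter_block_cong) (auto simp: S_def dest!: R)
    also have "\<dots> = LB # letter_block L k"
      using km fin by (intro letter_block_insert_left) (auto dest!: L)
    finally have "letter_block S k = LB # letter_block L k" .
    moreover have "map (letter_block S) [Suc k..<Suc m] = map (letter_block L) [Suc k..<Suc m]"
      using km by (intro map_cong letter_block_cong) (auto simp: S_def dest!: R)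
    ultimately show ?thesis
      using Node.IH(1)[of k] km unfolding L_def[symmetric] m_def[symmetric]
      by (simp add: upt_conv_Cons del: upt_Suc map_eq_conv)
  qed
  have right: "concat (map (letter_block S) [Suc m..<Suc b]) = tree_string (Suc m) r @ [RB]"
  proof -
    have "letter_block S b = letter_block (insert (k, b) R) b"
      using km by (intro letter_block_cong) (auto simp: S_def dest!: L)
    also have "\<dots> = letter_block R b @ [RB]"
      using km fin by (intro letter_block_insert_right) (auto dest!: R)
    finally have "letter_block S b = letter_block R b @ [RB]" .
    moreover have "map (letter_block S) [Suc m..<b] = map (letter_block R) [Suc m..<b]"
      using km by (intro map_cong letter_block_cong) (auto simp: S_def dest!: L)
    ultimately show ?thesis
      using Node.IH(2)[of "Suc m"] km unfolding R_def[symmetric] b_def[symmetric]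
      by (simp del: map_eq_conv)
  qed
  have "[k..<Suc b] = [k..<Suc m] @ [Suc m..<Suc b]"
    using km upt_add_eq_append[of k "Suc m" "b - m"] by simp
  with left right show ?case
    unfolding S by (simp add: b_def m_def size1_size add.assoc del: upt_Suc)
qed

text \<open>The elbows in column \<open>c\<close> are in bijection with the spans beginning with
  \<open>c\<close>, those with \<open>n + 2 - i = c\<close> with the spans ending there; so each
  block has the right bracket counts.\<close>

lemma bracketing_eq_tree_string:
  assumes "corresponds n D t"
  shows "bracketing n D = tree_string 1 t"
proof -
  let ?S = "node_spans 1 t"
  note el = corresponds_elbows[OF assms]
  have [simp]: "size t = n"
    using assms unfolding corresponds_def by blast
  have bound: "1 \<le> p \<and> p < q \<and> q \<le> n + 1" if "(p, q) \<in> ?S" for p q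
    using node_spans_bounds[OF that] by simp
  then have le: "p \<le> n + 2" "q \<le> n + 2" "n + 2 - (n + 2 - q) = q" if "(p, q) \<in> ?S" for p q
    using that by fastforce+
  have le': "i \<le> n + 2" if "(p, n + 2 - i) \<in> ?S" for i p
    using bound[OF that] by linarith
  have "card {(i, j) \<in> elbows n D. j = c} = card {q. (c, q) \<in> ?S}" for c
    by (rule bij_betw_same_card[of "\<lambda>(i, j). n + 2 - i"], rule bij_betw_byWitness[of _ "\<lambda>q. (n + 2 - q, c)"])
      (auto simp: el le[unfolded One_nat_def add_2_eq_Suc'] dest: le'[unfolded One_nat_def add_2_eq_Suc'])
  moreover have "card {(i, j) \<in> elbows n D. n + 2 - i = c} = card {p. (p, c) \<in> ?S}" for c
    by (rule bij_betw_same_card[of snd], rule bij_betw_byWitness[of _ "\<lambda>p. (n + 2 - c, p)"])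
      (auto simp: el le[unfolded One_nat_def add_2_eq_Suc'] dest: le'[unfolded One_nat_def add_2_eq_Suc'])
  ultimately show ?thesis
    using concat_letter_blocks[of 1 t]
    unfolding bracketing_def letter_block_def by simp
qed

text \<open>The tail \<open>ys\<close> makes the induction work, since relabelling continues with
  the next label after the subtree.\<close>

lemma relabel_rev_tree_string:
  "relabel k' (rev (map flip_token (tree_string k t)) @ ys) = tree_string k' (mirror t) @ relabel (k' + size1 t) ys"
  by (induction t arbitrary: k k' ys) (simp_all add: ac_simps)

lemma reverse_tree_string: "reverse_bracketing (tree_string 1 t) = tree_string 1 (mirror t)"
  using relabel_rev_tree_string[of 1 1 t "[]"] by (simp add: reverse_bracketing_def)

text \<open>Mirroring reflects the letters by \<open>x\<close> to
  \<open>k + k' + size t - x\<close>, which swaps the two ends of a span.\<close>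

lemma node_spans_mirror_imp:
  assumes "(p, q) \<in> node_spans k t"
  shows "(k + k' + size t - q, k + k' + size t - p) \<in> node_spans k' (mirror t)"
  using assms
proof (induction t arbitrary: k k')
  case (Node l x r)
  from Node.prems consider "p = k" "q = Suc (k + size l + size r)"
    | "(p, q) \<in> node_spans k l" | "(p, q) \<in> node_spans (Suc (k + size l)) r"
    by auto
  then show ?case
  proof cases
    case 2
    \<comment> \<open>The mirrored left child now follows the mirrored right child, hence the
      shifted start.\<close>
    from Node.IH(1)[OF this, of "Suc (k' + size r)"] show ?thesis by (simp add: ac_simps)
  next
    case 3
    from Node.IH(2)[OF this, of k'] show ?thesis by (simp add: ac_simps)
  qed (simp add: ac_simps)
qed simp

lemma corresponds_transpose:
  assumes "corresponds n D t"
  shows "corresponds n (D\<inverse>) (mirror t)"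
proof -
  from assms have sub: "D \<subseteq> {(i, j). 1 \<le> i \<and> 1 \<le> j \<and> i + j \<le> n + 1}" and [simp]: "size t = n"
    unfolding corresponds_def by auto
  have "letter_elbow n (D\<inverse>) j r \<longleftrightarrow> (j, r) \<in> node_spans 1 (mirror t)"
    if jr: "1 \<le> j" "j < r" "r \<le> n + 1" for j r
  proof -
    have "letter_elbow n (D\<inverse>) j r \<longleftrightarrow> letter_elbow n D (n + 2 - r) (n + 2 - j)"
      using jr by simp
    also have "\<dots> \<longleftrightarrow> (n + 2 - r, n + 2 - j) \<in> node_spans 1 t"
    proof -
      have "1 \<le> n + 2 - r \<and> n + 2 - r < n + 2 - j \<and> n + 2 - j \<le> n + 1"
        using jr by auto
      with assms show ?thesis unfolding corresponds_def by blast
    qed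
    \<comment> \<open>The converse comes from reflecting again, as \<open>mirror\<close> is an
      involution.\<close>
    also have "\<dots> \<longleftrightarrow> (j, r) \<in> node_spans 1 (mirror t)"
      using node_spans_mirror_imp[of "n + 2 - r" "n + 2 - j" 1 t 1]
        node_spans_mirror_imp[of j r 1 "mirror t" 1] jr by auto
    finally show ?thesis .
  qed
  with sub show ?thesis
    unfolding corresponds_def by auto
qed

text \<open>Spans in the left child end before those in the right child begin, and the root span
  fits into neither.\<close>

lemma leaf_span_inj: "inj_on (leaf_span k t) (internal_nodes t)"
proof (induction t arbitrary: k)
  case (Node l x r)
  have l: "k \<le> fst s \<and> fst s < snd s \<and> snd s \<le> k + size l" if "s \<in> leaf_span k l ` internal_nodes l" for s
    using node_spans_bounds[of "fst s" "snd s" k l] that unfolding node_spans_def by simp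
  have r: "Suc (k + size l) \<le> fst s \<and> fst s < snd s"
    if "s \<in> leaf_span (Suc (k + size l)) r ` internal_nodes r" for s
    using node_spans_bounds[of "fst s" "snd s" "Suc (k + size l)" r] that unfolding node_spans_def by simp
  show ?case
  proof (rule inj_onI)
    fix v w assume *: "v \<in> internal_nodes (Node l x r)" "w \<in> internal_nodes (Node l x r)"
      "leaf_span k (Node l x r) v = leaf_span k (Node l x r) w"
    have cases: "v = [] \<or> (\<exists>v'\<in>internal_nodes l. v = False # v') \<or> (\<exists>v'\<in>internal_nodes r. v = True # v')"
      if "v \<in> internal_nodes (Node l x r)" for v
      using that by auto
    note i = inj_onD[OF Node.IH(1)[of k]] inj_onD[OF Node.IH(2)[of "Suc (k + size l)"]]
    have ll: "k \<le> fst (leaf_span k l v) \<and> snd (leaf_span k l v) \<le> k + size l"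
      if "v \<in> internal_nodes l" for v using l that by blast
    have rr: "Suc (k + size l) \<le> fst (leaf_span (Suc (k + size l)) r v)"
      if "v \<in> internal_nodes r" for v using r that by blast
    have lr: "leaf_span k l v \<noteq> leaf_span (Suc (k + size l)) r w"
      if "v \<in> internal_nodes l" "w \<in> internal_nodes r" for v w
      using l[of "leaf_span k l v"] rr[OF that(2)] that(1) by force
    have l0: "leaf_span k l v \<noteq> (k, Suc (k + (size l + size r)))" if "v \<in> internal_nodes l" for v
      using ll[OF that] by auto
    have r0: "leaf_span (Suc (k + size l)) r v \<noteq> (k, z)" if "v \<in> internal_nodes r" for v z
      using rr[OF that] by auto
    from cases[OF *(1)] cases[OF *(2)] *(3) show "v = w"
      using i lr l0 r0 lr[symmetric] l0[symmetric] r0[symmetric]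
      by (elim disjE bexE) (simp_all add: size1_size ac_simps)
  qed
qed simp


section \<open>Matching pairs of brackets\<close>

lemma balanced_append:
  assumes "balanced x" "balanced y"
  shows "balanced (x @ y)"
  unfolding balanced_def
proof (intro conjI allI impI)
  show "count_list (x @ y) RB = count_list (x @ y) LB"
    using assms by (simp add: balanced_def)
  fix l assume l: "l \<le> length (x @ y)"
  show "count_list (take l (x @ y)) RB \<le> count_list (take l (x @ y)) LB"
  proof (cases "l \<le> length x")
    case True
    with assms(1) show ?thesis by (simp add: balanced_def)
  next
    case False
    with assms l show ?thesis by (simp add: balanced_def)
  qed
qed

lemma balanced_bracket:
  assumes "balanced x"
  shows "balanced ([LB] @ x @ [RB])"
  unfolding balanced_def
proof (intro conjI allI impI)
  show "count_list ([LB] @ x @ [RB]) RB = count_list ([LB] @ x @ [RB]) LB"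
    using assms by (simp add: balanced_def)
  fix l assume l: "l \<le> length ([LB] @ x @ [RB])"
  consider "l = 0" | k where "l = Suc k" "k \<le> length x" | "l = Suc (Suc (length x))"
    using l by (cases l) (auto simp: le_Suc_eq)
  then show "count_list (take l ([LB] @ x @ [RB])) RB \<le> count_list (take l ([LB] @ x @ [RB])) LB"
  proof cases
    case (2 k)
    with assms have "count_list (take k x) RB \<le> count_list (take k x) LB"
      unfolding balanced_def by blast
    with 2 show ?thesis by simp
  qed (use assms in \<open>auto simp: balanced_def\<close>)
qed

lemma balanced_tree_string: "balanced (tree_string k t)"
proof (induction t arbitrary: k)
  case Leaf
  show ?case by (simp add: balanced_def take_Cons')
next
  case (Node l x r)
  from balanced_bracket[OF balanced_append[OF Node.IH]] show ?case by simp
qed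

lemma length_tree_string: "length (tree_string k t) = Suc (3 * size t)"
  by (induction t arbitrary: k) auto

lemma tree_string_left: "\<exists>m z. tree_string k t = replicate m LB @ Letter k # z \<and> (t \<noteq> Leaf \<longrightarrow> 0 < m)"
proof (induction t arbitrary: k)
  case Leaf
  show ?case by (intro exI[of _ 0]) simp
next
  case (Node l x r)
  then obtain m z where "tree_string k l = replicate m LB @ Letter k # z"
    by blast
  then have "tree_string k (Node l x r)
      = replicate (Suc m) LB @ Letter k # (z @ tree_string (k + size1 l) r @ [RB])"
    by simp
  then show ?case by blast
qed

lemma tree_string_right:
  "\<exists>m z. tree_string k t = z @ Letter (k + size t) # replicate m RB \<and> (t \<noteq> Leaf \<longrightarrow> 0 < m)"
proof (induction t arbitrary: k)
  case Leaf
  show ?case by (intro exI[of _ 0]) simp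
next
  case (Node l x r)
  obtain m z where *: "tree_string (k + size1 l) r = z @ Letter (k + size1 l + size r) # replicate m RB"
    using Node.IH(2)[of "k + size1 l"] by blast
  have "tree_string k (Node l x r)
      = (LB # tree_string k l @ z) @ Letter (k + size (Node l x r)) # replicate (Suc m) RB"
    unfolding tree_string.simps * by (simp add: size1_size replicate_append_same ac_simps)
  then show ?case by blast
qed

text \<open>Otherwise the content up to \<open>q'\<close> has a prefix, the balanced content up to
  \<open>q\<close> followed by its \<open>RB\<close>, with one right bracket too many.\<close>

lemma matching_pairs_unique_aux:
  assumes "(p, q) \<in> matching_pairs s" "(p, q') \<in> matching_pairs s"
  shows "\<not> q < q'"
proof
  assume "q < q'"
  define u where "u = drop (Suc p) s"
  define d where "d = q - Suc p"
  from assms have q: "p < q" "q < length s" "s ! q = RB" "q' < length s"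
    and b: "balanced (take d u)" and b': "balanced (take (q' - Suc p) u)"
    unfolding matching_pairs_def u_def d_def by auto
  from q have "d < length u" "u ! d = RB"
    unfolding u_def d_def by auto
  then have t: "take (Suc d) u = take d u @ [RB]"
    by (simp add: take_Suc_conv_app_nth)
  have "Suc d \<le> q' - Suc p" "q' - Suc p \<le> length u"
    using \<open>q < q'\<close> q unfolding u_def d_def by auto
  then have "Suc d \<le> length (take (q' - Suc p) u)" "take (Suc d) (take (q' - Suc p) u) = take (Suc d) u"
    by (simp_all add: min_def)
  with b' have "count_list (take (Suc d) u) RB \<le> count_list (take (Suc d) u) LB"
    unfolding balanced_def by metis
  with t b show False
    by (simp add: balanced_def)
qed

lemma matching_pairs_unique:
  "(p, q) \<in> matching_pairs s \<Longrightarrow> (p, q') \<in> matching_pairs s \<Longrightarrow> q = q'"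
  using matching_pairs_unique_aux[of p q s q'] matching_pairs_unique_aux[of p q' s q] by simp

lemma left_bracket_before_unique:
  assumes "left_bracket_before s p a" "left_bracket_before s p a'"
  shows "a = a'"
proof -
  obtain x x' where
    x: "p < x" "s ! x = Letter a" "\<forall>y\<in>{p..<x}. s ! y = LB" and
    x': "p < x'" "s ! x' = Letter a'" "\<forall>y\<in>{p..<x'}. s ! y = LB"
    using assms unfolding left_bracket_before_def by blast
  have "\<not> x < x'" using x x'(3) by auto
  moreover have "\<not> x' < x" using x' x(3) by auto
  ultimately show ?thesis using x x' by simp
qed

lemma right_bracket_after_unique:
  assumes "right_bracket_after s q b" "right_bracket_after s q b'"
  shows "b = b'"
proof -
  obtain x x' where
    x: "x < q" "s ! x = Letter b" "\<forall>y\<in>{x<..q}. s ! y = RB" and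
    x': "x' < q" "s ! x' = Letter b'" "\<forall>y\<in>{x'<..q}. s ! y = RB"
    using assms unfolding right_bracket_after_def by blast
  have "\<not> x < x'" using x(3) x' by auto
  moreover have "\<not> x' < x" using x'(3) x by auto
  ultimately show ?thesis using x x' by simp
qed

lemma left_bracket_beforeI:
  assumes "0 < m"
  shows "left_bracket_before (u @ replicate m LB @ Letter a # z) (length u) a"
  unfolding left_bracket_before_def
  using assms by (intro exI[of _ "length u + m"]) (auto simp: nth_append)

lemma right_bracket_afterI:
  assumes "0 < m"
  shows "right_bracket_after (z @ Letter b # replicate m RB @ w) (length z + m) b"
  unfolding right_bracket_after_def
  using assms by (auto simp: nth_append nth_Cons' intro!: exI[of _ "length z"])

text \<open>The indices of the two brackets of a node; the string of a subtree \<open>t\<close> has length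
  \<open>3 * size t + 1\<close>.\<close>

fun node_brackets :: "plane_tree \<Rightarrow> bool list \<Rightarrow> nat \<times> nat" where
  "node_brackets t [] = (0, 3 * size t)"
| "node_brackets Leaf (_ # v) = (0, 0)"
| "node_brackets (Node l _ r) (False # v) = map_prod Suc Suc (node_brackets l v)"
| "node_brackets (Node l _ r) (True # v) =
     map_prod ((+) (3 * size l + 2)) ((+) (3 * size l + 2)) (node_brackets r v)"

text \<open>Cuts out the substring of the node's subtree, so that its brackets can be studied as
  outermost ones.\<close>

lemma subtree_string:
  assumes "v \<in> internal_nodes t"
  shows "\<exists>u w t' c. t' \<noteq> Leaf \<and> tree_string k t = u @ tree_string c t' @ w
    \<and> leaf_span k t v = (c, c + size t') \<and> node_brackets t v = (length u, length u + 3 * size t')"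
  using assms
proof (induction t arbitrary: k v)
  case (Node l x r)
  let ?t = "Node l x r"
  from Node.prems consider "v = []" | v' where "v = False # v'" "v' \<in> internal_nodes l"
    | v' where "v = True # v'" "v' \<in> internal_nodes r"
    by auto
  then show ?case
  proof cases
    case 1
    then have "?t \<noteq> Leaf \<and> tree_string k ?t = [] @ tree_string k ?t @ []
      \<and> leaf_span k ?t v = (k, k + size ?t)
      \<and> node_brackets ?t v = (length [], length [] + 3 * size ?t)"
      by (simp add: size1_size)
    then show ?thesis by blast
  next
    case (2 v')
    from Node.IH(1)[OF 2(2), of k] obtain u w t' c where *: "t' \<noteq> Leaf"
      "tree_string k l = u @ tree_string c t' @ w" "leaf_span k l v' = (c, c + size t')"
      "node_brackets l v' = (length u, length u + 3 * size t')"
      by blast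
    have "tree_string k ?t = (LB # u) @ tree_string c t' @ (w @ tree_string (k + size1 l) r @ [RB])"
      using * by simp
    moreover have "leaf_span k ?t v = (c, c + size t')"
      "node_brackets ?t v = (length (LB # u), length (LB # u) + 3 * size t')"
      using * 2 by simp_all
    ultimately show ?thesis using *(1) by blast
  next
    case (3 v')
    from Node.IH(2)[OF 3(2), of "k + size1 l"] obtain u w t' c where *: "t' \<noteq> Leaf"
      "tree_string (k + size1 l) r = u @ tree_string c t' @ w"
      "leaf_span (k + size1 l) r v' = (c, c + size t')"
      "node_brackets r v' = (length u, length u + 3 * size t')"
      by blast
    have "tree_string k ?t = (LB # tree_string k l @ u) @ tree_string c t' @ (w @ [RB])"
      using * by simp
    moreover have "leaf_span k ?t v = (c, c + size t')"
      "node_brackets ?t v =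
        (length (LB # tree_string k l @ u), length (LB # tree_string k l @ u) + 3 * size t')"
      using * 3 by (simp_all add: length_tree_string)
    ultimately show ?thesis using *(1) by blast
  qed
qed simp

lemma node_brackets_matching:
  assumes "v \<in> internal_nodes t"
  shows "node_brackets t v \<in> matching_pairs (tree_string k t)"
proof -
  obtain u w t' c where *: "t' \<noteq> Leaf" "tree_string k t = u @ tree_string c t' @ w"
    "node_brackets t v = (length u, length u + 3 * size t')"
    using subtree_string[OF assms, of k] by blast
  from *(1) obtain l x r where t': "t' = Node l x r"
    by (cases t') auto
  define y where "y = tree_string c l @ tree_string (c + size1 l) r"
  have y: "balanced y" "Suc (length y) = 3 * size t'"
    unfolding y_def t' by (simp_all add: balanced_append balanced_tree_string length_tree_string)
  have s: "tree_string k t = u @ LB # y @ RB # w"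
    using *(2) unfolding y_def t' by simp
  show ?thesis
    unfolding s *(3) y(2)[symmetric] matching_pairs_def using y(1) by (simp add: nth_append)
qed

lemma left_bracket_is_node:
  assumes "p < length (tree_string k t)" "tree_string k t ! p = LB"
  shows "\<exists>v\<in>internal_nodes t. fst (node_brackets t v) = p"
  using assms
proof (induction t arbitrary: k p)
  case (Node l x r)
  consider "p = 0" | p' where "p = Suc p'" "p' < length (tree_string k l)"
    | p' where "p = Suc (length (tree_string k l) + p')" "p' < length (tree_string (k + size1 l) r)"
    | "p = Suc (length (tree_string k l) + length (tree_string (k + size1 l) r))"
  proof (cases p)
    case (Suc p')
    with Node.prems(1) consider "p' < length (tree_string k l)"
      | "length (tree_string k l) \<le> p'" "p' - length (tree_string k l) < length (tree_string (k + size1 l) r)"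
      | "p' = length (tree_string k l) + length (tree_string (k + size1 l) r)"
      by fastforce
    then show ?thesis
      using that(1,2,4) that(3)[of "p' - length (tree_string k l)"] Suc by cases auto
  qed simp
  then show ?case
  proof cases
    case 1
    then show ?thesis by simp
  next
    case (2 p')
    with Node.prems have "tree_string k l ! p' = LB" by (simp add: nth_append)
    from Node.IH(1)[OF 2(2) this] obtain v where "v \<in> internal_nodes l" "fst (node_brackets l v) = p'"
      by blast
    with 2(1) show ?thesis by (intro bexI[of _ "False # v"]) simp_all
  next
    case (3 p')
    with Node.prems have "tree_string (k + size1 l) r ! p' = LB" by (simp add: nth_append)
    from Node.IH(2)[OF 3(2) this] obtain v where "v \<in> internal_nodes r" "fst (node_brackets r v) = p'"
      by blast
    with 3(1) show ?thesis by (intro bexI[of _ "True # v"]) (simp_all add: length_tree_string)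
  next
    case 4
    with Node.prems show ?thesis by (simp add: nth_append)
  qed
qed simp

text \<open>Each left bracket belongs to a node and has only one partner, so there are no pairs
  besides those of nodes.\<close>

lemma matching_pairs_tree_string:
  "matching_pairs (tree_string k t) = node_brackets t ` internal_nodes t"
proof
  show "node_brackets t ` internal_nodes t \<subseteq> matching_pairs (tree_string k t)"
    using node_brackets_matching by blast
  show "matching_pairs (tree_string k t) \<subseteq> node_brackets t ` internal_nodes t"
  proof
    fix x assume x: "x \<in> matching_pairs (tree_string k t)"
    obtain p q where [simp]: "x = (p, q)" by fastforce
    from x have "p < length (tree_string k t)" "tree_string k t ! p = LB"
      unfolding matching_pairs_def by auto
    then obtain v where v: "v \<in> internal_nodes t" "fst (node_brackets t v) = p"
      using left_bracket_is_node by blast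
    then have "node_brackets t v = (p, snd (node_brackets t v))"
      by auto
    with node_brackets_matching[OF v(1), of k] matching_pairs_unique x
    have "node_brackets t v = x" by (metis \<open>x = (p, q)\<close>)
    with v(1) show "x \<in> node_brackets t ` internal_nodes t" by blast
  qed
qed

lemma node_brackets_placed:
  assumes "v \<in> internal_nodes t" "leaf_span k t v = (a, b)" "node_brackets t v = (p, q)"
  shows "left_bracket_before (tree_string k t) p a" "right_bracket_after (tree_string k t) q b"
proof -
  obtain u w t' c where *: "t' \<noteq> Leaf" "tree_string k t = u @ tree_string c t' @ w"
    "leaf_span k t v = (c, c + size t')" "node_brackets t v = (length u, length u + 3 * size t')"
    using subtree_string[OF assms(1), of k] by blast
  obtain m z where m: "tree_string c t' = replicate m LB @ Letter c # z" "0 < m"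
    using tree_string_left[of c t'] *(1) by blast
  show "left_bracket_before (tree_string k t) p a"
    using left_bracket_beforeI[OF m(2), of u c "z @ w"] * m assms by simp
  obtain m' z' where m': "tree_string c t' = z' @ Letter (c + size t') # replicate m' RB" "0 < m'"
    using tree_string_right[of c t'] *(1) by blast
  have "length z' + m' = 3 * size t'"
    using length_tree_string[of c t'] m'(1) by simp
  then have "q = length (u @ z') + m'" using * assms by simp
  then show "right_bracket_after (tree_string k t) q b"
    using right_bracket_afterI[OF m'(2), of "u @ z'" "c + size t'" w] * m' assms by simp
qed

text \<open>Spans link elbows to nodes, and \<open>node_brackets\<close> links nodes to matching
  pairs.\<close>

lemma corresponds_one_to_one:
  assumes D: "corresponds n D t"
  shows "one_to_one (placed_for n (tree_string 1 t)) (elbows n D) (matching_pairs (tree_string 1 t))"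
    and "one_to_one (node_of_elbow n t) (elbows n D) (internal_nodes t)"
proof -
  let ?s = "tree_string 1 t"
  note el = corresponds_elbows[OF D]
  have node: "\<exists>!v. v \<in> internal_nodes t \<and> leaf_span 1 t v = (j, n + 2 - i)" if "(i, j) \<in> elbows n D" for i j
  proof -
    from that el obtain v where "v \<in> internal_nodes t" "leaf_span 1 t v = (j, n + 2 - i)"
      unfolding node_spans_def by (metis imageE)
    then show ?thesis
      using inj_onD[OF leaf_span_inj[of 1 t]] by metis
  qed
  have [simp]: "size t = n" using D unfolding corresponds_def by blast
  have elbow: "\<exists>!x. x \<in> elbows n D \<and> leaf_span 1 t v = (snd x, n + 2 - fst x)"
    if v: "v \<in> internal_nodes t" for v
  proof -
    obtain a b where ab: "leaf_span 1 t v = (a, b)" by fastforce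
    then have "(a, b) \<in> node_spans 1 t"
      using v unfolding node_spans_def by force
    moreover from this have b: "b \<le> n + 1" using node_spans_bounds by fastforce
    ultimately have "(n + 2 - b, a) \<in> elbows n D"
      using el by simp
    moreover have "x = (n + 2 - b, a)" if "x \<in> elbows n D" "(a, b) = (snd x, n + 2 - fst x)" for x
      using that unfolding elbows_def by auto
    ultimately show ?thesis
      unfolding ab using b by (intro ex1I[of _ "(n + 2 - b, a)"]) auto
  qed
  show "one_to_one (node_of_elbow n t) (elbows n D) (internal_nodes t)"
    unfolding one_to_one_def node_of_elbow_def using node elbow by (auto simp: case_prod_unfold)
  \<comment> \<open>A bracket determines the letter of its block, so placement at a node's brackets
    forces equality of spans.\<close>
  have placed: "placed_for n ?s x (node_brackets t v) \<longleftrightarrow> leaf_span 1 t v = (snd x, n + 2 - fst x)"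
    if "v \<in> internal_nodes t" for x v
  proof -
    obtain a b p q where ab: "leaf_span 1 t v = (a, b)" and pq: "node_brackets t v = (p, q)"
      by fastforce
    from node_brackets_placed[OF that ab pq] show ?thesis
      unfolding placed_for_def ab pq case_prod_unfold
      by (auto dest: left_bracket_before_unique right_bracket_after_unique)
  qed
  show "one_to_one (placed_for n ?s) (elbows n D) (matching_pairs ?s)"
    unfolding one_to_one_def matching_pairs_tree_string
  proof (intro conjI ballI)
    fix x assume x: "x \<in> elbows n D"
    have "\<exists>!v. v \<in> internal_nodes t \<and> leaf_span 1 t v = (snd x, n + 2 - fst x)"
      by (rule node) (use x in simp)
    then obtain v where v: "v \<in> internal_nodes t" "leaf_span 1 t v = (snd x, n + 2 - fst x)"
      and u: "\<And>v'. v' \<in> internal_nodes t \<Longrightarrow> leaf_span 1 t v' = (snd x, n + 2 - fst x) \<Longrightarrow> v' = v"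
      by blast
    show "\<exists>!y. y \<in> node_brackets t ` internal_nodes t \<and> placed_for n ?s x y"
      by (rule ex1I[of _ "node_brackets t v"]) (use v u placed in blast)+
  next
    fix y assume "y \<in> node_brackets t ` internal_nodes t"
    then obtain v where "v \<in> internal_nodes t" "y = node_brackets t v" by blast
    with elbow[of v] placed[of v] show "\<exists>!x. x \<in> elbows n D \<and> placed_for n ?s x y"
      by simp
  qed
qed

section \<open>Assembly of the bijections and symmetries\<close>

theorem mainTheorem4:
  fixes n :: nat
  assumes "n \<ge> 1"
  shows
    "(\<forall>D \<in> rc_graphs (n + 1) (w_perm n).
        full_bracketing [1..<n + 2] (bracketing n D)
      \<and> one_to_one (placed_for n (bracketing n D))
          (elbows n D) (matching_pairs (bracketing n D))
      \<and> one_to_one (node_of_elbow n (tree_of (bracketing n D)))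
          (elbows n D) (internal_nodes (tree_of (bracketing n D))))
   \<and> bij_betw (bracketing n) (rc_graphs (n + 1) (w_perm n)) {s. full_bracketing [1..<n + 2] s}
   \<and> bij_betw (\<lambda>D. tree_of (bracketing n D)) (rc_graphs (n + 1) (w_perm n)) {t. size1 t = n + 1}
   \<and> (\<forall>D \<in> rc_graphs (n + 1) (w_perm n).
        D\<inverse> \<in> rc_graphs (n + 1) (w_perm n)
      \<and> bracketing n (D\<inverse>) = reverse_bracketing (bracketing n D)
      \<and> tree_of (bracketing n (D\<inverse>)) = mirror (tree_of (bracketing n D)))"
proof -
  let ?A = "rc_graphs (n + 1) (w_perm n)"
  have corr: "corresponds n D (tree_of (bracketing n D))
      \<and> bracketing n D = tree_string 1 (tree_of (bracketing n D))" if "D \<in> ?A" for D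
    using rc_graph_imp_corresponds[OF that] bracketing_eq_tree_string tree_of_tree_string by metis
  have tree: "tree_of (bracketing n D) = t" if "corresponds n D t" for D t
    using bracketing_eq_tree_string[OF that] tree_of_tree_string by simp
  have bij: "bij_betw (\<lambda>D. tree_of (bracketing n D)) ?A {t. size1 t = n + 1}"
    unfolding bij_betw_def
  proof
    show "inj_on (\<lambda>D. tree_of (bracketing n D)) ?A"
      using corr corresponds_unique by (intro inj_onI) metis
    show "(\<lambda>D. tree_of (bracketing n D)) ` ?A = {t. size1 t = n + 1}"
    proof
      show "(\<lambda>D. tree_of (bracketing n D)) ` ?A \<subseteq> {t. size1 t = n + 1}"
        using corr by (auto simp: corresponds_def size1_size)
      show "{t. size1 t = n + 1} \<subseteq> (\<lambda>D. tree_of (bracketing n D)) ` ?A"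
      proof
        fix t :: plane_tree assume "t \<in> {t. size1 t = n + 1}"
        then obtain D where D: "corresponds n D t"
          using corresponds_ex[of t n] by (auto simp: size1_size)
        from corresponds_imp_rc_graph[OF D] tree[OF D]
        show "t \<in> (\<lambda>D. tree_of (bracketing n D)) ` ?A" by blast
      qed
    qed
  qed
  have full: "full_bracketing [1..<n + 2] (bracketing n D)" if "D \<in> ?A" for D
  proof -
    have "size1 (tree_of (bracketing n D)) = n + 1"
      using bij_betwE[OF bij] that by blast
    then have "[1..<1 + size1 (tree_of (bracketing n D))] = [1..<n + 2]"
      by (intro arg_cong2[where f = upt]) simp_all
    with full_bracketing_tree_string[of 1 "tree_of (bracketing n D)"] corr[OF that]
    show ?thesis by metis
  qed
  have "bracketing n ` ?A \<subseteq> {s. full_bracketing [1..<n + 2] s}"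
    using full by blast
  \<comment> \<open>Bijectivity onto strings follows from that onto trees by cancelling the
    bijection \<open>tree_of\<close>.\<close>
  from bij_betw_comp_iff2[OF bij_betw_tree_of this]
  have "bij_betw (bracketing n) ?A {s. full_bracketing [1..<n + 2] s}"
    using bij unfolding comp_def by blast
  moreover have "D\<inverse> \<in> ?A \<and> bracketing n (D\<inverse>) = reverse_bracketing (bracketing n D)
      \<and> tree_of (bracketing n (D\<inverse>)) = mirror (tree_of (bracketing n D))" if "D \<in> ?A" for D
  proof -
    from corr[OF that] have D: "corresponds n (D\<inverse>) (mirror (tree_of (bracketing n D)))"
      and s: "bracketing n D = tree_string 1 (tree_of (bracketing n D))"
      by (blast intro: corresponds_transpose)+
    have "bracketing n (D\<inverse>) = reverse_bracketing (bracketing n D)"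
      using bracketing_eq_tree_string[OF D] reverse_tree_string s by metis
    with corresponds_imp_rc_graph[OF D] tree[OF D] show ?thesis by blast
  qed
  ultimately show ?thesis
    using full bij corr corresponds_one_to_one by metis
qed

end
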